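(* Let $g\in L^2(\mathbb{R}^d)$ with $\|g\|_2=1$ and let $\Omega\subset\mathbb{R}^{2d}$ be compact. Then $$\rho_{R\cdot\Omega}(R\,\cdot)\longrightarrow 1_\Omega\quad\text{in }L^1(\mathbb{R}^{2d}),\ \text{as }R\to+\infty,$$ where $\rho_{R\cdot\Omega}$ is the accumulated spectrogram of the dilated set $R\cdot\Omega=\{Rz: z\in\Omega\}$ with respect to the window $g$.
   Context: For $f\in L^2(\mathbb{R}^d)$ and $z=(x,\xi)\in\mathbb{R}^d\times\mathbb{R}^d$, the short-time Fourier transform is $V_gf(x,\xi)=\int_{\mathbb{R}^d}f(t)\overline{g(t-x)}e^{-2\pi i\xi\cdot t}\,dt$. For compact $\Omega\subset\mathbb{R}^{2d}$, the time-frequency localization operator $H_\Omega$ on $L^2(\mathbb{R}^d)$ is $H_\Omega f(t)=\int_\Omega V_gf(x,\xi)g(t-x)e^{2\pi i\xi\cdot t}\,dx\,d\xi$, i.e. $H_\Omega f=V_g^*(1_\Omega\cdot V_gf)$; it is a compact positive operator. Let $\lambda_1^\Omega\ge\lambda_2^\Omega\ge\dots$ be its non-zero eigenvalues, counted with multiplicity and ordered non-increasingly, and $\{h_k^\Omega\}_{k\ge1}$ a corresponding orthonormal set of eigenfunctions. $|\Omega|$ denotes Lebesgue measure and $A_\Omega=\lceil|\Omega|\rceil$ is the smallest integer $\ge|\Omega|$. The accumulated spectrogram of $\Omega$ (with respect to $g$) is $\rho_\Omega(z)=\sum_{k=1}^{A_\Omega}|V_gh_k^\Omega(z)|^2$,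 $z\in\mathbb{R}^{2d}$. The function $1_\Omega$ is the characteristic function of $\Omega$. *)

theory Defs
  imports "HOL-Analysis.Analysis"
begin

text \<open>
  The space of dimension d is a type of class \<open>euclidean_space\<close> and the phase space of dimension
  2d is its product with itself. Elements of \<open>L\<^sup>2\<close> are represented by Borel measurable functions, and
  equality in \<open>L\<^sup>2\<close> is equality almost everywhere.
\<close>

definition L2 :: "('a::euclidean_space \<Rightarrow> complex) set" where
  "L2 = {f. f \<in> borel_measurable lborel \<and> integrable lborel (\<lambda>t. (cmod (f t))\<^sup>2)}"

definition L2_inner :: "('a::euclidean_space \<Rightarrow> complex) \<Rightarrow> ('a \<Rightarrow> complex) \<Rightarrow> complex" where
  "L2_inner f h = (LINT t|lborel. f t * cnj (h t))"

definition L2_norm :: "('a::euclidean_space \<Rightarrow> complex) \<Rightarrow> real" where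
  "L2_norm f = sqrt (LINT t|lborel. (cmod (f t))\<^sup>2)"

definition stft :: "('a::euclidean_space \<Rightarrow> complex) \<Rightarrow> ('a \<Rightarrow> complex) \<Rightarrow> 'a \<times> 'a \<Rightarrow> complex" where
  "stft g f = (\<lambda>(x, \<xi>).
     LINT t|lborel. f t * cnj (g (t - x)) * exp (- (2 * of_real pi * \<i> * of_real (\<xi> \<bullet> t))))"

text \<open>
  For compact \<open>\<Omega>\<close> and \<open>f, g\<close> in \<open>L\<^sup>2\<close> the integrand below is absolutely integrable for every \<open>t\<close>
  (the transform of \<open>f\<close> is bounded and \<open>g\<close> is locally integrable), so the operator is
  given pointwise.
\<close>

definition loc_op ::
    "('a::euclidean_space \<Rightarrow> complex) \<Rightarrow> ('a \<times> 'a) set \<Rightarrow> ('a \<Rightarrow> complex) \<Rightarrow> 'a \<Rightarrow> complex" where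
  "loc_op g \<Omega> f t =
     (LINT (x, \<xi>):\<Omega>|lborel. stft g f (x, \<xi>) * g (t - x) * exp (2 * of_real pi * \<i> * of_real (\<xi> \<bullet> t)))"

definition eigenspace ::
    "(('a::euclidean_space \<Rightarrow> complex) \<Rightarrow> 'a \<Rightarrow> complex) \<Rightarrow> complex \<Rightarrow> ('a \<Rightarrow> complex) set" where
  "eigenspace T \<mu> = {f \<in> L2. AE t in lborel. T f t = \<mu> * f t}"

text \<open>
  \<open>lam 1 \<ge> lam 2 \<ge> \<dots>\<close> is the list of the non-zero eigenvalues of \<open>T\<close>, counted with multiplicity, and
  \<open>h 1, h 2, \<dots>\<close> is a corresponding orthonormal set of eigenfunctions. The list has length \<open>N\<close>, which
  may be finite or infinite; values at indices outside \<open>1, \<dots>, N\<close> are irrelevant. The last conjunct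
  makes the list exhaustive: for each \<open>\<mu> \<noteq> 0\<close>, the \<open>h k\<close> with \<open>lam k = \<mu>\<close> form an orthonormal basis of
  the eigenspace of \<open>\<mu>\<close>, so \<open>\<mu>\<close> is listed as many times as its multiplicity (in particular not at all if
  it is not an eigenvalue).
\<close>

definition ordered_eigensystem ::
    "(('a::euclidean_space \<Rightarrow> complex) \<Rightarrow> 'a \<Rightarrow> complex) \<Rightarrow> enat \<Rightarrow> (nat \<Rightarrow> real) \<Rightarrow>
     (nat \<Rightarrow> 'a \<Rightarrow> complex) \<Rightarrow> bool" where
  "ordered_eigensystem T N lam h \<longleftrightarrow>
     (let I = {k. 1 \<le> k \<and> enat k \<le> N} in
       (\<forall>k\<in>I. lam k \<noteq> 0 \<and> h k \<in> eigenspace T (of_real (lam k))) \<and>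
       (\<forall>j\<in>I. \<forall>k\<in>I. j \<le> k \<longrightarrow> lam k \<le> lam j) \<and>
       (\<forall>j\<in>I. \<forall>k\<in>I. L2_inner (h j) (h k) = (if j = k then 1 else 0)) \<and>
       (\<forall>\<mu> f. \<mu> \<noteq> 0 \<and> f \<in> eigenspace T \<mu> \<longrightarrow>
          (\<exists>S c. finite S \<and> S \<subseteq> {k \<in> I. of_real (lam k) = \<mu>} \<and>
                 (AE t in lborel. f t = (\<Sum>k\<in>S. c k * h k t)))))"

definition A_count :: "('a::euclidean_space) set \<Rightarrow> nat" where
  "A_count \<Omega> = nat \<lceil>measure lborel \<Omega>\<rceil>"

text \<open>
  The accumulated spectrogram built from a choice \<open>h\<close> of eigenfunctions. The non-zero eigenvalues of
  the localization operator lie in \<open>(0, 1]\<close> and sum up to the measure of \<open>\<Omega>\<close>, so there are at least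
  \<open>A_count \<Omega>\<close> of them and the sum involves only genuine eigenfunctions.
\<close>

definition acc_spectrogram ::
    "('a::euclidean_space \<Rightarrow> complex) \<Rightarrow> ('a \<times> 'a) set \<Rightarrow> (nat \<Rightarrow> 'a \<Rightarrow> complex) \<Rightarrow> 'a \<times> 'a \<Rightarrow> real" where
  "acc_spectrogram g \<Omega> h z = (\<Sum>k = 1..A_count \<Omega>. (cmod (stft g (h k) z))\<^sup>2)"

definition dilate :: "real \<Rightarrow> ('a::euclidean_space) set \<Rightarrow> 'a set" where
  "dilate R \<Omega> = (\<lambda>z. R *\<^sub>R z) ` \<Omega>"

definition L1_tendsto ::
    "('i \<Rightarrow> 'a::euclidean_space \<Rightarrow> real) \<Rightarrow> ('a \<Rightarrow> real) \<Rightarrow> 'i filter \<Rightarrow> bool" where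
  "L1_tendsto F f net \<longleftrightarrow>
     (\<forall>\<^sub>F i in net. integrable lborel (F i)) \<and> integrable lborel f \<and>
     ((\<lambda>i. LINT z|lborel. \<bar>F i z - f z\<bar>) \<longlongrightarrow> 0) net"

end

theory Submission
  imports Defs "HOL-Probability.Characteristic_Functions" "HOL-Complex_Analysis.Great_Picard"
begin

text \<open>
  Write \<open>H\<close> for the localization operator of \<open>\<Omega>\<close>, with eigenvalues \<open>\<lambda>\<^sub>k \<in> (0, 1]\<close>, and \<open>B = 1\<^sub>\<Omega> * \<bar>V\<^sub>g g\<bar>\<^sup>2\<close>
  (up to a reflection). Expanding \<open>\<langle>H \<pi>(z) g, \<pi>(z) g\<rangle> = B(z)\<close> in eigenfunctions gives
  \<open>B = \<Sum> \<lambda>\<^sub>k \<bar>V\<^sub>g h\<^sub>k\<bar>\<^sup>2\<close>; integrating over phase space and over \<open>\<Omega>\<close> yields the traces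
  \<open>\<Sum> \<lambda>\<^sub>k = \<bar>\<Omega>\<bar>\<close> and \<open>\<Sum> \<lambda>\<^sub>k\<^sup>2 = \<integral>\<^sub>\<Omega> B\<close>. As the \<open>\<lambda>\<^sub>k\<close> decrease and \<open>A \<ge> \<bar>\<Omega>\<bar>\<close>, the tail
  \<open>\<Sum>\<^sub>k\<^sub>>\<^sub>A \<lambda>\<^sub>k\<close> is at most \<open>\<Sum> \<lambda>\<^sub>k (1 - \<lambda>\<^sub>k) = \<bar>\<Omega>\<bar> - \<integral>\<^sub>\<Omega> B\<close>. Comparing both the accumulated spectrogram
  and the indicator of \<open>\<Omega>\<close> with \<open>B\<close> bounds their \<open>L\<^sup>1\<close> distance by \<open>1 + 4 (\<bar>\<Omega>\<bar> - \<integral>\<^sub>\<Omega> B)\<close>. After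
  dilation by \<open>R\<close> and rescaling, the first term is \<open>R\<close> to the power \<open>-2d\<close> and \<open>\<bar>V\<^sub>g g\<bar>\<^sup>2\<close> becomes an
  approximate identity, so the bound tends to 0.
\<close>

section \<open>Affine substitutions and square integrable functions\<close>

text \<open>The delicate point is the expansion of B, because an eigensystem is only known to
  exhaust the eigenspaces. The expansion is therefore derived variationally from the quadratic form
  <H f, f>. On the orthogonal complement of the leading n eigenfunctions the supremum of the form
  over the unit ball is either 0 or attained at an eigenfunction. Exhaustiveness identifies its
  eigenvalue with a later entry of the list, so the remainder after n terms is at most lambda_(n+1)
  ||f||^2. These eigenvalues tend to 0 because the partial sums, all below B, already give one half
  of the trace formula. Moyal's identity is used in three ways: the spectrogram of a unit vector has
  integral 1, H is bounded by the identity, and |V_g g|^2 is a probability density. In the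
  comparison, the partial sum of lambda_k |V_g h_k|^2 over k <= A lies below both the accumulated
  spectrogram and B, so both distances are plain differences of integrals and only the two traces
  matter.\<close>

lemma nn_integral_lborel_affine:
  fixes f :: "'b::euclidean_space \<Rightarrow> ennreal"
  assumes [measurable]: "f \<in> borel_measurable borel" and c: "c \<noteq> 0"
  shows "(\<integral>\<^sup>+x. f x \<partial>lborel) = ennreal (\<bar>c\<bar> ^ DIM('b)) * (\<integral>\<^sup>+x. f (t + c *\<^sub>R x) \<partial>lborel)"
  by (subst lborel_affine[OF c, of t])
     (simp add: nn_integral_density nn_integral_distr nn_integral_cmult)

lemma integrable_lborel_affine_iff:
  fixes f :: "'b::euclidean_space \<Rightarrow> 'c::{banach, second_countable_topology}"
  assumes c: "c \<noteq> 0" and [measurable]: "f \<in> borel_measurable borel"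
  shows "integrable lborel (\<lambda>x. f (t + c *\<^sub>R x)) \<longleftrightarrow> integrable lborel f"
proof -
  have "integrable lborel f \<longleftrightarrow>
      integrable (density (distr lborel borel (\<lambda>x. t + c *\<^sub>R x)) (\<lambda>_. \<bar>c\<bar>^DIM('b))) f"
    by (subst lborel_affine[OF c, of t]) simp
  also have "\<dots> \<longleftrightarrow> integrable lborel (\<lambda>x. f (t + c *\<^sub>R x))"
    proof -
    have "integrable lborel (\<lambda>x. k *\<^sub>R h x) \<longleftrightarrow> integrable lborel h"
      if "k \<noteq> 0" for k and h :: "'b \<Rightarrow> 'c"
      using integrable_scaleR_right[of "inverse k" lborel "\<lambda>x. k *\<^sub>R h x"]
        integrable_scaleR_right[of k lborel h] that by auto
    with c show ?thesis
      by (subst integrable_density) (simp_all add: integrable_distr_eq)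
  qed
  finally show ?thesis by simp
qed

lemma integral_lborel_affine:
  fixes f :: "'b::euclidean_space \<Rightarrow> 'c::{banach, second_countable_topology}"
  assumes c: "c \<noteq> 0" and [measurable]: "f \<in> borel_measurable borel"
  shows "(LINT x|lborel. f x) = \<bar>c\<bar> ^ DIM('b) *\<^sub>R (LINT x|lborel. f (t + c *\<^sub>R x))"
proof -
  have "(LINT x|lborel. f x) =
      (LINT x|density (distr lborel borel (\<lambda>x. t + c *\<^sub>R x)) (\<lambda>_. \<bar>c\<bar>^DIM('b)). f x)"
    by (subst lborel_affine[OF c, of t]) simp
  also have "\<dots> = \<bar>c\<bar> ^ DIM('b) *\<^sub>R (LINT x|lborel. f (t + c *\<^sub>R x))"
    by (subst integral_density) (simp_all add: integral_distr)
  finally show ?thesis .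
qed

lemma
  fixes f :: "'b::euclidean_space \<Rightarrow> 'c::{banach, second_countable_topology}"
  assumes [measurable]: "f \<in> borel_measurable borel"
  shows integrable_lborel_shift: "integrable lborel (\<lambda>x. f (x - t)) \<longleftrightarrow> integrable lborel f"
    and integral_lborel_shift: "(LINT x|lborel. f (x - t)) = (LINT x|lborel. f x)"
    and integrable_lborel_plus: "integrable lborel (\<lambda>x. f (x + t)) \<longleftrightarrow> integrable lborel f"
    and integral_lborel_plus: "(LINT x|lborel. f (x + t)) = (LINT x|lborel. f x)"
    and integrable_lborel_reflect: "integrable lborel (\<lambda>x. f (t - x)) \<longleftrightarrow> integrable lborel f"
    and integral_lborel_reflect: "(LINT x|lborel. f (t - x)) = (LINT x|lborel. f x)"
  using integrable_lborel_affine_iff[of 1 f "- t"] integral_lborel_affine[of 1 f "- t"]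
    integrable_lborel_affine_iff[of 1 f t] integral_lborel_affine[of 1 f t]
    integrable_lborel_affine_iff[of "-1" f t] integral_lborel_affine[of "-1" f t]
  by (simp_all add: add.commute)

lemma
  fixes f :: "'b::euclidean_space \<Rightarrow> ennreal"
  assumes [measurable]: "f \<in> borel_measurable borel"
  shows nn_integral_lborel_shift: "(\<integral>\<^sup>+x. f (x - t) \<partial>lborel) = (\<integral>\<^sup>+x. f x \<partial>lborel)"
    and nn_integral_lborel_reflect: "(\<integral>\<^sup>+x. f (t - x) \<partial>lborel) = (\<integral>\<^sup>+x. f x \<partial>lborel)"
  using nn_integral_lborel_affine[of f 1 "- t"]
    nn_integral_lborel_affine[of f "-1" t]
  by (simp_all add: add.commute)

lemma borel_measurable_cnj [measurable (raw)]:
  "f \<in> borel_measurable M \<Longrightarrow> (\<lambda>x. cnj (f x)) \<in> borel_measurable M"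
  by (rule borel_measurable_continuous_on[OF continuous_on_cnj]) (rule continuous_on_id)

lemma L2_measurable [measurable_dest]: "f \<in> L2 \<Longrightarrow> f \<in> borel_measurable borel"
  by (simp add: L2_def)

lemma L2_integrable: "f \<in> L2 \<Longrightarrow> integrable lborel (\<lambda>t. (cmod (f t))\<^sup>2)"
  by (simp add: L2_def)

lemma L2I: "f \<in> borel_measurable borel \<Longrightarrow> integrable lborel (\<lambda>t. (cmod (f t))\<^sup>2) \<Longrightarrow> f \<in> L2"
  by (simp add: L2_def)

lemma cmod_add_square_le: "(cmod (a + b))\<^sup>2 \<le> 2 * (cmod a)\<^sup>2 + 2 * (cmod b)\<^sup>2"
proof -
  have "(cmod (a + b))\<^sup>2 \<le> (cmod a + cmod b)\<^sup>2"
    by (intro power_mono norm_triangle_ineq) simp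
  also have "\<dots> \<le> 2 * (cmod a)\<^sup>2 + 2 * (cmod b)\<^sup>2"
    using sum_squares_bound[of "cmod a" "cmod b"] by (simp add: power2_sum)
  finally show ?thesis .
qed

lemma L2_dominated:
  assumes "f \<in> borel_measurable borel" "integrable lborel k" "\<And>t. (cmod (f t))\<^sup>2 \<le> k t"
  shows "f \<in> L2"
  using assms by (intro L2I Bochner_Integration.integrable_bound[OF assms(2)]) (auto intro: order_trans[OF _ abs_ge_self])

lemma L2_zero: "(\<lambda>_. 0) \<in> L2"
  by (simp add: L2_def)

lemma L2_add: "f \<in> L2 \<Longrightarrow> h \<in> L2 \<Longrightarrow> (\<lambda>t. f t + h t) \<in> L2"
  by (rule L2_dominated[where k="\<lambda>t. 2 * (cmod (f t))\<^sup>2 + 2 * (cmod (h t))\<^sup>2"])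
     (auto intro!: Bochner_Integration.integrable_add integrable_mult_right
       dest: L2_integrable L2_measurable simp: cmod_add_square_le)

lemma L2_scale: "f \<in> L2 \<Longrightarrow> (\<lambda>t. c * f t) \<in> L2"
  by (rule L2_dominated[where k="\<lambda>t. (cmod c)\<^sup>2 * (cmod (f t))\<^sup>2"])
     (auto dest: L2_integrable L2_measurable simp: norm_mult power_mult_distrib)

lemma L2_diff: "f \<in> L2 \<Longrightarrow> h \<in> L2 \<Longrightarrow> (\<lambda>t. f t - h t) \<in> L2"
  using L2_add[of f "\<lambda>t. (-1) * h t"] L2_scale[of h "-1"] by simp

lemma L2_sum: "(\<And>k. k \<in> S \<Longrightarrow> f k \<in> L2) \<Longrightarrow> (\<lambda>t. \<Sum>k\<in>S. f k t) \<in> L2"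
  by (induction S rule: infinite_finite_induct) (simp_all add: L2_zero L2_add)

lemma L2_inner_integrable:
  assumes "f \<in> L2" "h \<in> L2"
  shows "integrable lborel (\<lambda>t. f t * cnj (h t))"
proof (rule Bochner_Integration.integrable_bound)
  show "integrable lborel (\<lambda>t. (cmod (f t))\<^sup>2 + (cmod (h t))\<^sup>2)"
    using assms by (simp add: L2_integrable)
  show "(\<lambda>t. f t * cnj (h t)) \<in> borel_measurable lborel"
    using assms[THEN L2_measurable] by measurable
  have "cmod a * cmod b \<le> (cmod a)\<^sup>2 + (cmod b)\<^sup>2" for a b
    using sum_squares_bound[of "cmod a" "cmod b"] mult_nonneg_nonneg[OF norm_ge_zero norm_ge_zero, of a b]
    by linarith
  then show "AE t in lborel. norm (f t * cnj (h t)) \<le> norm ((cmod (f t))\<^sup>2 + (cmod (h t))\<^sup>2)"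
    by (auto simp: norm_mult)
qed

lemma L2_inner_commute: "L2_inner h f = cnj (L2_inner f h)"
  unfolding L2_inner_def using Bochner_Integration.integral_cnj[of lborel "\<lambda>t. f t * cnj (h t)"] by (simp add: mult.commute)

lemma L2_inner_diff_left:
  "f \<in> L2 \<Longrightarrow> f' \<in> L2 \<Longrightarrow> h \<in> L2 \<Longrightarrow> L2_inner (\<lambda>t. f t - f' t) h = L2_inner f h - L2_inner f' h"
  by (simp add: L2_inner_def left_diff_distrib L2_inner_integrable)

lemma L2_inner_diff_right:
  "f \<in> L2 \<Longrightarrow> f' \<in> L2 \<Longrightarrow> h \<in> L2 \<Longrightarrow> L2_inner h (\<lambda>t. f t - f' t) = L2_inner h f - L2_inner h f'"
  by (simp add: L2_inner_def right_diff_distrib L2_inner_integrable)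

lemma L2_inner_scale_left: "L2_inner (\<lambda>t. c * f t) h = c * L2_inner f h"
  by (simp add: L2_inner_def mult.assoc)

lemma L2_inner_scale_right: "L2_inner h (\<lambda>t. c * f t) = cnj c * L2_inner h f"
  by (simp add: L2_inner_def mult.left_commute)

lemma L2_inner_sum_left:
  assumes "\<And>k. k \<in> S \<Longrightarrow> f k \<in> L2" "h \<in> L2"
  shows "L2_inner (\<lambda>t. \<Sum>k\<in>S. f k t) h = (\<Sum>k\<in>S. L2_inner (f k) h)"
  using assms by (simp add: L2_inner_def sum_distrib_right L2_inner_integrable)

lemma L2_inner_cong_AE:
  assumes "f \<in> L2" "f' \<in> L2" "h \<in> L2" "AE t in lborel. f t = f' t"
  shows "L2_inner f h = L2_inner f' h"
proof -
  note assms(1-3)[THEN L2_measurable, measurable]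
  show ?thesis
    unfolding L2_inner_def using assms(4) by (intro integral_cong_AE) auto
qed

lemma L2_norm_nonneg: "0 \<le> L2_norm f"
  by (simp add: L2_norm_def)

lemma L2_norm_square: "(L2_norm f)\<^sup>2 = (LINT t|lborel. (cmod (f t))\<^sup>2)"
  by (simp add: L2_norm_def)

lemma L2_inner_self: "L2_inner f f = of_real ((L2_norm f)\<^sup>2)"
  unfolding L2_inner_def L2_norm_square complex_norm_square[symmetric]
  by (rule integral_complex_of_real)

lemma L2_norm_scale: "L2_norm (\<lambda>t. c * f t) = cmod c * L2_norm f"
  by (simp add: L2_norm_def norm_mult power_mult_distrib real_sqrt_mult)

lemma nn_integral_L2_norm:
  "f \<in> L2 \<Longrightarrow> (\<integral>\<^sup>+t. ennreal ((cmod (f t))\<^sup>2) \<partial>lborel) = ennreal ((L2_norm f)\<^sup>2)"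
  by (simp add: L2_norm_square nn_integral_eq_integral L2_integrable)

text \<open>The modulus stands inside the integral because the Fubini arguments need majorants for
  their kernels, not only bounds for inner products.\<close>

lemma L2_Cauchy_Schwarz_abs:
  assumes "f \<in> L2" "h \<in> L2"
  shows "(LINT t|lborel. cmod (f t) * cmod (h t)) \<le> L2_norm f * L2_norm h"
proof -
  note assms[THEN L2_measurable, measurable]
  have int: "integrable lborel (\<lambda>t. cmod (f t) * cmod (h t))"
    using L2_inner_integrable[OF assms] by (subst (asm) integrable_norm_iff[symmetric]) (simp_all add: norm_mult)
  have "(\<integral>\<^sup>+t. ennreal (cmod (f t)) * ennreal (cmod (h t)) \<partial>lborel)\<^sup>2
     \<le> (\<integral>\<^sup>+t. (ennreal (cmod (f t)))\<^sup>2 \<partial>lborel) * (\<integral>\<^sup>+t. (ennreal (cmod (h t)))\<^sup>2 \<partial>lborel)"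
    by (rule Cauchy_Schwarz_nn_integral) auto
  also have "\<dots> = ennreal ((L2_norm f)\<^sup>2 * (L2_norm h)\<^sup>2)"
    using assms by (simp add: ennreal_power nn_integral_L2_norm ennreal_mult)
  also have "(\<integral>\<^sup>+t. ennreal (cmod (f t)) * ennreal (cmod (h t)) \<partial>lborel) =
      ennreal (LINT t|lborel. cmod (f t) * cmod (h t))"
    using int by (simp add: nn_integral_eq_integral flip: ennreal_mult)
  finally have "(LINT t|lborel. cmod (f t) * cmod (h t))\<^sup>2 \<le> (L2_norm f * L2_norm h)\<^sup>2"
    by (simp add: ennreal_power power_mult_distrib)
  then show ?thesis
    by (rule power2_le_imp_le) (simp add: L2_norm_nonneg)
qed

lemma L2_Cauchy_Schwarz:
  assumes "f \<in> L2" "h \<in> L2"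
  shows "cmod (L2_inner f h) \<le> L2_norm f * L2_norm h"
proof -
  have "cmod (L2_inner f h) \<le> (LINT t|lborel. cmod (f t) * cmod (h t))"
    unfolding L2_inner_def using integral_norm_bound[of lborel "\<lambda>t. f t * cnj (h t)"]
    by (simp add: norm_mult)
  with L2_Cauchy_Schwarz_abs[OF assms] show ?thesis by simp
qed

lemma L2_norm_add_square_le:
  assumes "f \<in> L2" "h \<in> L2"
  shows "(L2_norm (\<lambda>t. f t + h t))\<^sup>2 \<le> 2 * (L2_norm f)\<^sup>2 + 2 * (L2_norm h)\<^sup>2"
proof -
  have "(L2_norm (\<lambda>t. f t + h t))\<^sup>2 \<le> (LINT t|lborel. 2 * (cmod (f t))\<^sup>2 + 2 * (cmod (h t))\<^sup>2)"
    unfolding L2_norm_square using assms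
    by (intro integral_mono) (auto simp: L2_integrable L2_add cmod_add_square_le)
  also have "\<dots> = 2 * (L2_norm f)\<^sup>2 + 2 * (L2_norm h)\<^sup>2"
    using assms by (simp add: L2_norm_square L2_integrable)
  finally show ?thesis .
qed

section \<open>Continuity of translations\<close>

text \<open>The map \<open>a \<mapsto> |a| a\<close> turns \<open>L\<^sup>2\<close> into \<open>L\<^sup>1\<close> and has a Hoelder continuous inverse; this
  transfers continuity of translations from \<open>L\<^sup>1\<close> to \<open>L\<^sup>2\<close>.\<close>

lemma cmod_diff_square_le:
  "(cmod (a - b))\<^sup>2 \<le> 2 * cmod (of_real (cmod a) * a - of_real (cmod b) * b)"
proof (cases "a = b")
  case False
  let ?p = "cmod a" and ?q = "cmod b"
  let ?w = "of_real ?p * a - of_real ?q * b"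
  have pq: "?p\<^sup>2 = (Re a)\<^sup>2 + (Im a)\<^sup>2" "?q\<^sup>2 = (Re b)\<^sup>2 + (Im b)\<^sup>2"
    by (simp_all add: cmod_power2)
  \<comment> \<open>Pairing \<open>?w\<close> with \<open>a - b\<close> gives the identity 2 Re <w,
    a - b> = (p + q) |a - b|^2 + (p - q)^2 (p + q). Dropping the last term, bounding the left side
    by 2 |w| |a - b| and cancelling |a - b| leaves (p + q) |a - b| <= 2 |w|; finally |a - b| <= p +
    q.\<close>
  have "Re (?w * cnj (a - b)) = ?p * ?p\<^sup>2 + ?q * ?q\<^sup>2 - (?p + ?q) * (Re a * Re b + Im a * Im b)"
    unfolding pq by (simp add: algebra_simps power2_eq_square)
  also have "2 * \<dots> = (?p + ?q) * (cmod (a - b))\<^sup>2 + (?p - ?q)\<^sup>2 * (?p + ?q)"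
  proof -
    have D: "(cmod (a - b))\<^sup>2 = ?p\<^sup>2 + ?q\<^sup>2 - 2 * (Re a * Re b + Im a * Im b)"
      unfolding cmod_power2[of "a - b"] pq by (simp add: algebra_simps power2_eq_square)
    show ?thesis unfolding D by (simp add: algebra_simps power2_eq_square)
  qed
  finally have "(?p + ?q) * (cmod (a - b))\<^sup>2 \<le> 2 * Re (?w * cnj (a - b))"
    by (smt (verit) mult_nonneg_nonneg norm_ge_zero zero_le_power2)
  also have "\<dots> \<le> 2 * (cmod ?w * cmod (a - b))"
    using complex_Re_le_cmod[of "?w * cnj (a - b)"] unfolding norm_mult complex_mod_cnj by linarith
  finally have "((?p + ?q) * cmod (a - b)) * cmod (a - b) \<le> (2 * cmod ?w) * cmod (a - b)"
    by (simp add: power2_eq_square algebra_simps)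
  then have "(?p + ?q) * cmod (a - b) \<le> 2 * cmod ?w"
    using False by simp
  moreover have "cmod (a - b) * cmod (a - b) \<le> (?p + ?q) * cmod (a - b)"
    by (intro mult_right_mono norm_triangle_ineq4) simp
  ultimately show ?thesis by (simp add: power2_eq_square)
qed simp

text \<open>Continuity is phrased along sequences to suit dominated convergence, and as a predicate
  on \<open>F\<close> so that it can be carried through the induction over integrable
  functions.\<close>

definition L1_shift_cont :: "('b::euclidean_space \<Rightarrow> 'c::{banach, second_countable_topology}) \<Rightarrow> bool" where
  "L1_shift_cont F \<longleftrightarrow> (\<forall>u. u \<longlonglongrightarrow> 0 \<longrightarrow> (\<lambda>n::nat. LINT t|lborel. norm (F (t - u n) - F t)) \<longlonglongrightarrow> 0)"

text \<open>An e/3 argument: translation is an isometry of L1, so replacing \<open>F\<close> by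
  \<open>G\<close> costs the same error before and after the shift.\<close>

lemma L1_shift_contI:
  assumes F: "integrable lborel F"
    and "\<And>e. e > 0 \<Longrightarrow> \<exists>G. integrable lborel G \<and> (LINT t|lborel. norm (G t - F t)) \<le> e \<and> L1_shift_cont G"
  shows "L1_shift_cont F"
  unfolding L1_shift_cont_def
proof (intro allI impI)
  fix u :: "nat \<Rightarrow> 'a" assume u: "u \<longlonglongrightarrow> 0"
  note [measurable] = borel_measurable_integrable[OF F]
  show "(\<lambda>n. LINT t|lborel. norm (F (t - u n) - F t)) \<longlonglongrightarrow> 0"
  proof (rule LIMSEQ_I)
    fix e :: real assume e: "e > 0"
    then obtain G where G: "integrable lborel G" "(LINT t|lborel. norm (G t - F t)) \<le> e / 3" "L1_shift_cont G"
      using assms(2)[of "e / 3"] by auto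
    note [measurable] = borel_measurable_integrable[OF G(1)]
    have "(\<lambda>n. LINT t|lborel. norm (G (t - u n) - G t)) \<longlonglongrightarrow> 0"
      using G(3) u by (auto simp: L1_shift_cont_def)
    from LIMSEQ_D[OF this, of "e / 3"] e obtain n0
      where n0: "\<And>n. n \<ge> n0 \<Longrightarrow> norm ((LINT t|lborel. norm (G (t - u n) - G t)) - 0) < e / 3"
      by auto
    have "norm ((LINT t|lborel. norm (F (t - u n) - F t)) - 0) < e" if n: "n \<ge> n0" for n
    proof -
      have i: "integrable lborel (\<lambda>t. F (t - u n))" "integrable lborel (\<lambda>t. G (t - u n))"
        using F G by (simp_all add: integrable_lborel_shift)
      have "(LINT t|lborel. norm (F (t - u n) - F t)) \<le>
          (LINT t|lborel. norm (G (t - u n) - F (t - u n)) + norm (G (t - u n) - G t) + norm (G t - F t))"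
      proof (intro integral_mono)
        show "norm (F (t - u n) - F t) \<le>
          norm (G (t - u n) - F (t - u n)) + norm (G (t - u n) - G t) + norm (G t - F t)" for t
          using norm_triangle_ineq4[of "(G (t - u n) - G t) + (G t - F t)" "G (t - u n) - F (t - u n)"]
            norm_triangle_ineq[of "G (t - u n) - G t" "G t - F t"] by simp
      qed (use i F G in auto)
      also have "\<dots> = (LINT t|lborel. norm (G (t - u n) - F (t - u n)))
          + (LINT t|lborel. norm (G (t - u n) - G t)) + (LINT t|lborel. norm (G t - F t))"
        using i F G by simp
      also have "(LINT t|lborel. norm (G (t - u n) - F (t - u n))) = (LINT t|lborel. norm (G t - F t))"
        by (rule integral_lborel_shift[of "\<lambda>t. norm (G t - F t)"]) simp
      also have "\<dots> + (LINT t|lborel. norm (G (t - u n) - G t)) + (LINT t|lborel. norm (G t - F t)) < e"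
        using G(2) n0[OF n] by auto
      finally show ?thesis by simp
    qed
    then show "\<exists>n0. \<forall>n\<ge>n0. norm ((LINT t|lborel. norm (F (t - u n) - F t)) - 0) < e" by blast
  qed
qed

text \<open>The L1 distance of the two indicators is 2 |U| - 2 |U \<inter> (U + u)|. Openness makes
  a point of \<open>U\<close> stay in \<open>U\<close> under small shifts, and off \<open>U\<close>
  the product of indicators vanishes, so dominated convergence applies to the intersection.\<close>

lemma L1_shift_cont_open:
  fixes U :: "'b::euclidean_space set" and c :: "'c::{banach, second_countable_topology}"
  assumes "open U" and fin: "emeasure lborel U < \<infinity>"
  shows "L1_shift_cont (\<lambda>x. indicator U x *\<^sub>R c)"
  unfolding L1_shift_cont_def
proof (intro allI impI)
  fix u :: "nat \<Rightarrow> 'b" assume u: "u \<longlonglongrightarrow> 0"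
  have [measurable]: "U \<in> sets borel" using \<open>open U\<close> by simp
  have iU: "integrable lborel (indicat_real U)" using fin by simp
  have iU': "integrable lborel (\<lambda>t. indicat_real U (t - u n))" for n
    using iU by (simp add: integrable_lborel_shift)
  have iP: "integrable lborel (\<lambda>t. indicat_real U t * indicat_real U (t - u n))" for n
    by (rule Bochner_Integration.integrable_bound[OF iU]) (auto simp: indicator_def)
  have "(\<lambda>n. LINT t|lborel. indicat_real U t * indicat_real U (t - u n)) \<longlonglongrightarrow> (LINT t|lborel. indicat_real U t)"
  proof (rule integral_dominated_convergence[where w="indicat_real U"])
    show "AE t in lborel. (\<lambda>n. indicat_real U t * indicat_real U (t - u n)) \<longlonglongrightarrow> indicat_real U t"
    proof (rule AE_I2)
      fix t show "(\<lambda>n. indicat_real U t * indicat_real U (t - u n)) \<longlonglongrightarrow> indicat_real U t"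
      proof (cases "t \<in> U")
        case True
        have "(\<lambda>n. t - u n) \<longlonglongrightarrow> t" using tendsto_diff[OF tendsto_const u, of t] by simp
        then have "\<forall>\<^sub>F n in sequentially. t - u n \<in> U"
          using topological_tendstoD \<open>open U\<close> True by blast
        then have "\<forall>\<^sub>F n in sequentially. indicat_real U t * indicat_real U (t - u n) = 1"
          by eventually_elim (use True in simp)
        then show ?thesis using True by (simp add: tendsto_eventually)
      qed simp
    qed
  qed (use iU in \<open>auto simp: indicator_def\<close>)
  then have "(\<lambda>n. norm c * (2 * (LINT t|lborel. indicat_real U t) - 2 * (LINT t|lborel. indicat_real U t * indicat_real U (t - u n))))
     \<longlonglongrightarrow> norm c * (2 * (LINT t|lborel. indicat_real U t) - 2 * (LINT t|lborel. indicat_real U t))"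
    by (intro tendsto_intros)
  moreover have "(LINT t|lborel. norm (indicat_real U (t - u n) *\<^sub>R c - indicat_real U t *\<^sub>R c)) =
      norm c * (2 * (LINT t|lborel. indicat_real U t) - 2 * (LINT t|lborel. indicat_real U t * indicat_real U (t - u n)))" for n
  proof -
    have "(LINT t|lborel. norm (indicat_real U (t - u n) *\<^sub>R c - indicat_real U t *\<^sub>R c)) =
      (LINT t|lborel. norm c * (indicat_real U (t - u n) + indicat_real U t - 2 * (indicat_real U t * indicat_real U (t - u n))))"
      by (intro Bochner_Integration.integral_cong) (auto simp: indicator_def)
    also have "\<dots> = norm c * ((LINT t|lborel. indicat_real U (t - u n)) + (LINT t|lborel. indicat_real U t)
        - 2 * (LINT t|lborel. indicat_real U t * indicat_real U (t - u n)))"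
      using iU iU' iP by simp
    also have "(LINT t|lborel. indicat_real U (t - u n)) = (LINT t|lborel. indicat_real U t)"
      by (rule integral_lborel_shift) simp
    finally show ?thesis by simp
  qed
  ultimately show "(\<lambda>n. LINT t|lborel. norm (indicat_real U (t - u n) *\<^sub>R c - indicat_real U t *\<^sub>R c)) \<longlonglongrightarrow> 0"
    by simp
qed

text \<open>By outer regularity the indicator of a set of finite measure is an L1 limit of
  indicators of open sets; sums and dominated limits then reach every integrable function.\<close>

lemma integrable_L1_shift_cont:
  fixes F :: "'b::euclidean_space \<Rightarrow> 'c::{banach, second_countable_topology}"
  assumes "integrable lborel F"
  shows "L1_shift_cont F"
  using assms
proof (induction rule: integrable_induct)
  case (base A c)
  have [measurable]: "A \<in> sets borel" using base by simp
  show ?case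
  proof (rule L1_shift_contI)
    show "integrable lborel (\<lambda>x. indicator A x *\<^sub>R c)"
      using base by simp
    fix e :: real assume e: "e > 0"
    \<comment> \<open>The added 1 covers the case \<open>c = 0\<close>.\<close>
    define d where "d = e / (norm c + 1)"
    have d: "d > 0" using e by (simp add: d_def add_nonneg_pos)
    obtain U where U: "open U" "A \<subseteq> U" "emeasure lborel (U - A) < d"
      using outer_regular_lborel[OF _ d, of A] by auto
    have [measurable]: "U \<in> sets borel" using U by simp
    have "emeasure lborel U = emeasure lborel A + emeasure lborel (U - A)"
      using U(2) by (subst plus_emeasure) (auto intro!: arg_cong[where f="emeasure lborel"])
    then have fin: "emeasure lborel U < \<infinity>"
      using base(2) U(3) by (simp add: order_less_trans[OF U(3)])
    have fin': "emeasure lborel (U - A) < \<infinity>"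
      using U(3) by (simp add: order_less_trans[OF U(3)])
    have "(LINT t|lborel. norm (indicat_real U t *\<^sub>R c - indicat_real A t *\<^sub>R c)) =
        (LINT t|lborel. norm c * indicat_real (U - A) t)"
      using U(2) by (intro Bochner_Integration.integral_cong) (auto simp: indicator_def)
    also have "\<dots> = norm c * measure lborel (U - A)" by simp
    also have "\<dots> \<le> norm c * d"
      using U(3) d by (intro mult_left_mono) (auto simp: measure_def intro!: enn2real_leI)
    also have "\<dots> \<le> (norm c + 1) * d"
      using d by (intro mult_right_mono) auto
    also have "\<dots> = e"
      by (simp add: d_def add_nonneg_eq_0_iff)
    finally show "\<exists>G. integrable lborel G \<and> (LINT t|lborel. norm (G t - indicat_real A t *\<^sub>R c)) \<le> e \<and> L1_shift_cont G"
      using L1_shift_cont_open[OF U(1) fin] fin by (intro exI[of _ "\<lambda>x. indicator U x *\<^sub>R c"]) auto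
  qed
next
  case (add f g)
  note [measurable] = add(1,2)[THEN borel_measurable_integrable]
  show ?case
    unfolding L1_shift_cont_def
  proof (intro allI impI)
    fix u :: "nat \<Rightarrow> 'b" assume u: "u \<longlonglongrightarrow> 0"
    have lim: "(\<lambda>n. (LINT t|lborel. norm (f (t - u n) - f t)) + (LINT t|lborel. norm (g (t - u n) - g t))) \<longlonglongrightarrow> 0 + 0"
      using add u by (intro tendsto_add) (auto simp: L1_shift_cont_def)
    have le: "(LINT t|lborel. norm (f (t - u n) + g (t - u n) - (f t + g t))) \<le>
        (LINT t|lborel. norm (f (t - u n) - f t)) + (LINT t|lborel. norm (g (t - u n) - g t))" for n
    proof -
      have i: "integrable lborel (\<lambda>t. f (t - u n))" "integrable lborel (\<lambda>t. g (t - u n))"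
        using add by (simp_all add: integrable_lborel_shift)
      have "(LINT t|lborel. norm (f (t - u n) + g (t - u n) - (f t + g t))) \<le>
        (LINT t|lborel. norm (f (t - u n) - f t) + norm (g (t - u n) - g t))"
        using i add by (intro integral_mono) (auto simp: norm_diff_triangle_ineq)
      then show ?thesis using i add by simp
    qed
    show "(\<lambda>n. LINT t|lborel. norm (f (t - u n) + g (t - u n) - (f t + g t))) \<longlonglongrightarrow> 0"
      by (rule tendsto_sandwich[OF _ _ tendsto_const lim[simplified]]) (auto simp: le)
  qed
next
  case (lim f s)
  note [measurable] = lim(1,4)[THEN borel_measurable_integrable]
  show ?case
  proof (rule L1_shift_contI)
    show "integrable lborel f" by fact
    fix e :: real assume e: "e > 0"
    \<comment> \<open>The majorant 3 |f| comes from the bound |s i| <= 2 |f| that the induction rule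
      supplies.\<close>
    have "(\<lambda>i. LINT t|lborel. norm (s i t - f t)) \<longlonglongrightarrow> (LINT t|(lborel::'b measure). 0)"
    proof (rule integral_dominated_convergence[where w="\<lambda>t. 3 * norm (f t)"])
      show "AE t in lborel. (\<lambda>i. norm (s i t - f t)) \<longlonglongrightarrow> 0"
        using lim(2) by (intro AE_I2 tendsto_norm_zero) (simp add: LIM_zero)
      show "AE t in lborel. norm (norm (s i t - f t)) \<le> 3 * norm (f t)" for i
      proof (rule AE_I2)
        fix t show "norm (norm (s i t - f t)) \<le> 3 * norm (f t)"
          using lim(3)[of t i] norm_triangle_ineq4[of "s i t" "f t"] by simp
      qed
    qed (use lim in auto)
    then have "(\<lambda>i. LINT t|lborel. norm (s i t - f t)) \<longlonglongrightarrow> 0" by simp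
    from LIMSEQ_D[OF this e] obtain i where "norm ((LINT t|lborel. norm (s i t - f t)) - 0) < e" by blast
    then show "\<exists>G. integrable lborel G \<and> (LINT t|lborel. norm (G t - f t)) \<le> e \<and> L1_shift_cont G"
      using lim(1,5) by (intro exI[of _ "s i"]) auto
  qed
qed

lemma L1_shift_tendsto:
  fixes F :: "'b::euclidean_space \<Rightarrow> 'c::{banach, second_countable_topology}"
  assumes "integrable lborel F" "u \<longlonglongrightarrow> 0"
  shows "(\<lambda>n::nat. LINT t|lborel. norm (F (t - u n) - F t)) \<longlonglongrightarrow> 0"
  using integrable_L1_shift_cont[OF assms(1)] assms(2) by (simp add: L1_shift_cont_def)

lemma L2_shift: "f \<in> L2 \<Longrightarrow> (\<lambda>t. f (t - u)) \<in> L2"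
  by (auto intro!: L2I dest: L2_measurable L2_integrable
      simp: integrable_lborel_shift[of "\<lambda>t. (cmod (f t))\<^sup>2"])

lemma L2_norm_shift: "f \<in> L2 \<Longrightarrow> L2_norm (\<lambda>t. f (t - u)) = L2_norm f"
  by (simp add: L2_norm_def integral_lborel_shift[of "\<lambda>t. (cmod (f t))\<^sup>2"] L2_measurable)

lemma L2_shift_tendsto:
  assumes f: "f \<in> L2" and u: "u \<longlonglongrightarrow> 0"
  shows "(\<lambda>n::nat. (L2_norm (\<lambda>t. f (t - u n) - f t))\<^sup>2) \<longlonglongrightarrow> 0"
proof -
  note [measurable] = L2_measurable[OF f]
  let ?F = "\<lambda>t. of_real (cmod (f t)) * f t"
  have F: "integrable lborel ?F"
    using L2_integrable[OF f]
    by (subst integrable_norm_iff[symmetric]) (auto simp: norm_mult power2_eq_square)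
  have lim: "(\<lambda>n. 2 * (LINT t|lborel. norm (?F (t - u n) - ?F t))) \<longlonglongrightarrow> 0"
    using tendsto_mult_left[OF L1_shift_tendsto[OF F u], of 2] by simp
  have "(L2_norm (\<lambda>t. f (t - u n) - f t))\<^sup>2 \<le> 2 * (LINT t|lborel. norm (?F (t - u n) - ?F t))" for n
  proof -
    have "integrable lborel (\<lambda>t. ?F (t - u n))" using F by (subst integrable_lborel_shift) simp_all
    then show ?thesis
      unfolding L2_norm_square Bochner_Integration.integral_mult_right_zero[symmetric]
      using F L2_integrable[OF L2_diff[OF L2_shift[OF f] f]]
      by (intro integral_mono) (auto simp: cmod_diff_square_le)
  qed
  then show ?thesis
    by (intro tendsto_sandwich[OF _ _ tendsto_const lim]) auto
qed

section \<open>Integrals of coordinatewise products\<close>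

lemma
  fixes f :: "'b::euclidean_space \<Rightarrow> real \<Rightarrow> complex"
  assumes f: "\<And>b. b \<in> Basis \<Longrightarrow> integrable lborel (f b)"
  shows integrable_lborel_prod: "integrable lborel (\<lambda>x. \<Prod>b\<in>Basis. f b (x \<bullet> b))"
    and integral_lborel_prod: "(LINT x|lborel. (\<Prod>b\<in>Basis. f b (x \<bullet> b))) = (\<Prod>b\<in>Basis. (LINT x|lborel. f b x))"
proof -
  interpret product_sigma_finite "\<lambda>_::'b. lborel :: real measure" ..
  note [measurable] = f[THEN borel_measurable_integrable]
  have eq: "(\<Prod>b\<in>Basis. f b ((\<Sum>b\<in>Basis. h b *\<^sub>R b) \<bullet> b)) = (\<Prod>b\<in>Basis. f b (h b))" for h
    by (intro prod.cong) auto
  show "integrable lborel (\<lambda>x. \<Prod>b\<in>Basis. f b (x \<bullet> b))"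
    unfolding lborel_eq[where 'a='b]
    using product_integrable_prod[OF finite_Basis f] by (subst integrable_distr_eq) (simp_all add: eq)
  show "(LINT x|lborel. (\<Prod>b\<in>Basis. f b (x \<bullet> b))) = (\<Prod>b\<in>Basis. (LINT x|lborel. f b x))"
    unfolding lborel_eq[where 'a='b]
    using product_integral_prod[OF finite_Basis f] by (subst integral_distr) (simp_all add: eq)
qed

section \<open>The Gaussian and its Fourier transform\<close>

text \<open>The normalisation makes the function its own Fourier transform for the kernel exp (-2 pi
  i x.\<xi>), with integral 1. It serves as a regularising weight in the frequency variable.\<close>

definition gauss :: "'b::euclidean_space \<Rightarrow> real" where
  "gauss x = exp (- pi * (norm x)\<^sup>2)"

lemma gauss_measurable [measurable]: "gauss \<in> borel_measurable borel"
  unfolding gauss_def by measurable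

lemma gauss_nonneg: "0 \<le> gauss x"
  by (simp add: gauss_def)

lemma gauss_eq_prod: "gauss x = (\<Prod>b\<in>Basis. exp (- pi * (x \<bullet> b)\<^sup>2))"
proof -
  have "(norm x)\<^sup>2 = (\<Sum>b\<in>Basis. (x \<bullet> b)\<^sup>2)"
    unfolding power2_norm_eq_inner by (subst euclidean_inner) (simp add: power2_eq_square)
  then show ?thesis
    unfolding gauss_def exp_sum[OF finite_Basis, symmetric] sum_distrib_left[symmetric] by simp
qed

abbreviation ft_char :: "real \<Rightarrow> complex" where
  "ft_char s \<equiv> exp (- (2 * of_real pi * \<i> * of_real s))"

lemma norm_ft_char [simp]: "cmod (ft_char s) = 1"
  using norm_exp_i_times[of "- (2 * pi * s)"] by (simp add: mult_ac)

text \<open>The characteristic function exp (-v^2 / 2) of the standard normal law, taken at v = -c s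
  with c = sqrt (2 pi). The substitution x -> c x turns the normal density into exp (-pi x^2) / c,
  and the Jacobian c cancels the factor.\<close>

lemma gauss_fourier_real:
  shows "integrable lborel (\<lambda>x::real. of_real (exp (- pi * x\<^sup>2)) * ft_char (s * x))" (is "integrable _ ?f")
    and "(LINT x::real|lborel. of_real (exp (- pi * x\<^sup>2)) * ft_char (s * x)) = of_real (exp (- pi * s\<^sup>2))"
proof -
  define c where "c = sqrt (2 * pi)"
  have c: "c > 0" "c\<^sup>2 = 2 * pi" by (simp_all add: c_def)
  let ?d = "\<lambda>x::real. std_normal_density x *\<^sub>R exp (\<i> * of_real ((- c * s) * x))"
  have eq: "?d (0 + c * x) = (1 / c) *\<^sub>R ?f x" for x
  proof -
    have "(c * x)\<^sup>2 / 2 = pi * x\<^sup>2" using c by (simp add: power_mult_distrib)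
    moreover have "- c * s * (0 + c * x) = - (2 * pi * (s * x))"
      using c(2) by (simp add: power2_eq_square)
    moreover have "\<i> * of_real (- (2 * pi * (s * x))) = - (2 * of_real pi * \<i> * of_real (s * x))"
      by (simp add: mult_ac)
    ultimately show ?thesis
      unfolding std_normal_density_def c_def[symmetric] by (simp only:) (simp add: scaleR_conv_of_real)
  qed
  have "integrable lborel std_normal_density" by (rule integrable_normal_density) simp
  then have d: "integrable lborel ?d"
    by (subst integrable_norm_iff[symmetric]) (simp_all add: norm_mult)
  have "integrable lborel (\<lambda>x. (1 / c) *\<^sub>R ?f x)"
    using lborel_integrable_real_affine[OF d, of c 0] c unfolding eq by simp
  from integrable_scaleR_right[OF this, of c] c show "integrable lborel ?f" by simp
  have "of_real (exp (- ((- c * s)\<^sup>2) / 2)) = (LINT x|lborel. ?d x)"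
    using char_std_normal_distribution[THEN fun_cong, of "- c * s"]
    unfolding char_def by (subst (asm) integral_density) simp_all
  also have "\<dots> = c *\<^sub>R (LINT x|lborel. ?d (0 + c * x))"
    using c by (subst lborel_integral_real_affine[where c=c and t=0]) simp_all
  also have "\<dots> = (LINT x|lborel. ?f x)"
    unfolding eq using c by simp
  finally show "(LINT x|lborel. ?f x) = of_real (exp (- pi * s\<^sup>2))"
    using c by (simp add: power_mult_distrib)
qed

lemma
  fixes u :: "'b::euclidean_space"
  shows gauss_fourier_integrable: "integrable lborel (\<lambda>\<xi>. of_real (gauss \<xi>) * ft_char (\<xi> \<bullet> u))"
    and gauss_fourier: "(LINT \<xi>|lborel. of_real (gauss \<xi>) * ft_char (\<xi> \<bullet> u)) = of_real (gauss u)"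
proof -
  have eq: "of_real (gauss \<xi>) * ft_char (\<xi> \<bullet> u) =
      (\<Prod>b\<in>Basis. of_real (exp (- pi * (\<xi> \<bullet> b)\<^sup>2)) * ft_char ((u \<bullet> b) * (\<xi> \<bullet> b)))" for \<xi>
  proof -
    have "(\<Prod>b\<in>Basis. ft_char ((u \<bullet> b) * (\<xi> \<bullet> b))) =
        exp (\<Sum>b\<in>Basis. - (2 * of_real pi * \<i> * of_real ((u \<bullet> b) * (\<xi> \<bullet> b))))"
      by (rule exp_sum[OF finite_Basis, symmetric])
    also have "\<dots> = ft_char (\<Sum>b\<in>Basis. (u \<bullet> b) * (\<xi> \<bullet> b))"
      by (simp only: sum_negf sum_distrib_left of_real_sum)
    also have "\<dots> = ft_char (\<xi> \<bullet> u)"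
      by (simp only: inner_commute[of \<xi> u] euclidean_inner[of u \<xi>])
    finally show ?thesis
      by (simp only: gauss_eq_prod prod.distrib of_real_prod)
  qed
  show "integrable lborel (\<lambda>\<xi>. of_real (gauss \<xi>) * ft_char (\<xi> \<bullet> u))"
    unfolding eq by (intro integrable_lborel_prod gauss_fourier_real)
  show "(LINT \<xi>|lborel. of_real (gauss \<xi>) * ft_char (\<xi> \<bullet> u)) = of_real (gauss u)"
    unfolding eq integral_lborel_prod[OF gauss_fourier_real(1)] gauss_fourier_real(2)
    unfolding gauss_eq_prod of_real_prod ..
qed

lemma gauss_integrable: "integrable lborel (gauss :: 'b::euclidean_space \<Rightarrow> real)"
  using gauss_fourier_integrable[of "0::'b"] by (simp add: complex_of_real_integrable_eq)

lemma gauss_integral: "(LINT \<xi>::'b::euclidean_space|lborel. gauss \<xi>) = 1"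
proof -
  have "complex_of_real (LINT \<xi>::'b|lborel. gauss \<xi>) = of_real (gauss (0::'b))"
    using gauss_fourier[of "0::'b"] by simp
  then show ?thesis unfolding of_real_eq_iff by (simp add: gauss_def[of 0])
qed

lemma
  fixes c :: real and u :: "'b::euclidean_space"
  assumes c: "c > 0"
  shows gauss_dilate_integrable: "integrable lborel (\<lambda>\<xi>::'b. gauss (\<xi> /\<^sub>R c))"
    and gauss_dilate_fourier:
      "(LINT \<xi>|lborel. of_real (gauss (\<xi> /\<^sub>R c)) * ft_char (\<xi> \<bullet> u)) = of_real (c ^ DIM('b) * gauss (c *\<^sub>R u))"
proof -
  show "integrable lborel (\<lambda>\<xi>::'b. gauss (\<xi> /\<^sub>R c))"
    using integrable_lborel_affine_iff[of "inverse c" "gauss :: 'b \<Rightarrow> real" 0] c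
    by (simp add: gauss_integrable)
  show "(LINT \<xi>|lborel. of_real (gauss (\<xi> /\<^sub>R c)) * ft_char (\<xi> \<bullet> u)) = of_real (c ^ DIM('b) * gauss (c *\<^sub>R u))"
    using c gauss_fourier[of "c *\<^sub>R u"]
    by (subst integral_lborel_affine[of c _ 0]) (simp_all add: scaleR_conv_of_real)
qed

section \<open>Integrability and Fubini on a product of Euclidean spaces\<close>

lemma integrable_lborel_pairI:
  fixes F :: "'b::euclidean_space \<times> 'c::euclidean_space \<Rightarrow> 'd::{banach, second_countable_topology}"
  assumes [measurable]: "F \<in> borel_measurable borel"
    and "\<And>x. integrable lborel (\<lambda>y. F (x, y))"
    and "\<And>x. (LINT y|lborel. norm (F (x, y))) \<le> k x" "integrable lborel k"
  shows "integrable lborel F"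
proof -
  have [measurable]: "F \<in> borel_measurable (lborel \<Otimes>\<^sub>M lborel)"
    by (simp add: lborel_prod)
  have "integrable (lborel \<Otimes>\<^sub>M lborel) F"
  proof (rule lborel_pair.Fubini_integrable)
    show "integrable lborel (\<lambda>x. LINT y|lborel. norm (F (x, y)))"
      by (rule Bochner_Integration.integrable_bound[OF assms(4)])
        (use assms(3) in \<open>auto intro: order_trans[OF _ abs_ge_self]\<close>)
  qed (use assms in auto)
  then show ?thesis by (simp add: lborel_prod)
qed

lemma
  fixes F :: "'b::euclidean_space \<times> 'c::euclidean_space \<Rightarrow> 'd::{banach, second_countable_topology}"
  assumes "integrable lborel F"
  shows integral_lborel_pair_fst: "(LINT p|lborel. F p) = (LINT x|lborel. LINT y|lborel. F (x, y))"
    and integral_lborel_pair_snd: "(LINT p|lborel. F p) = (LINT y|lborel. LINT x|lborel. F (x, y))"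
    and integrable_lborel_pair_fst: "integrable lborel (\<lambda>x. LINT y|lborel. F (x, y))"
    and integrable_lborel_pair_snd: "integrable lborel (\<lambda>y. LINT x|lborel. F (x, y))"
proof -
  have F: "integrable (lborel \<Otimes>\<^sub>M lborel) F" using assms by (simp add: lborel_prod)
  show "(LINT p|lborel. F p) = (LINT x|lborel. LINT y|lborel. F (x, y))"
    using lborel_pair.integral_fst'[OF F] by (simp add: lborel_prod)
  show "(LINT p|lborel. F p) = (LINT y|lborel. LINT x|lborel. F (x, y))"
    using lborel_pair.integral_snd[of "\<lambda>x y. F (x, y)"] F by (simp add: lborel_prod)
  show "integrable lborel (\<lambda>x. LINT y|lborel. F (x, y))"
    using lborel_pair.integrable_fst'[OF F] by simp
  show "integrable lborel (\<lambda>y. LINT x|lborel. F (x, y))"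
    using lborel_pair.integrable_snd[of "\<lambda>x y. F (x, y)"] F by simp
qed

lemma nn_integral_lborel_pair_fst:
  fixes F :: "'b::euclidean_space \<times> 'c::euclidean_space \<Rightarrow> ennreal"
  assumes "F \<in> borel_measurable borel"
  shows "(\<integral>\<^sup>+p. F p \<partial>lborel) = (\<integral>\<^sup>+x. \<integral>\<^sup>+y. F (x, y) \<partial>lborel \<partial>lborel)"
  using lborel.nn_integral_fst[of F "lborel :: 'b measure"] assms by (simp add: lborel_prod)

lemma nn_integral_lborel_pair_snd:
  fixes F :: "'b::euclidean_space \<times> 'c::euclidean_space \<Rightarrow> ennreal"
  assumes "F \<in> borel_measurable borel"
  shows "(\<integral>\<^sup>+p. F p \<partial>lborel) = (\<integral>\<^sup>+y. \<integral>\<^sup>+x. F (x, y) \<partial>lborel \<partial>lborel)"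
  using lborel_pair.nn_integral_snd[of F] assms by (simp add: lborel_prod)

lemma measurable_fst_borel [measurable (raw)]:
  fixes f :: "'m \<Rightarrow> 'b::euclidean_space \<times> 'c::euclidean_space"
  assumes "f \<in> borel_measurable M" shows "(\<lambda>x. fst (f x)) \<in> borel_measurable M"
  using assms unfolding borel_prod[symmetric] by measurable

lemma measurable_snd_borel [measurable (raw)]:
  fixes f :: "'m \<Rightarrow> 'b::euclidean_space \<times> 'c::euclidean_space"
  assumes "f \<in> borel_measurable M" shows "(\<lambda>x. snd (f x)) \<in> borel_measurable M"
  using assms unfolding borel_prod[symmetric] by measurable

lemma integrable_lborel_pairI':
  fixes F :: "'b::euclidean_space \<times> 'c::euclidean_space \<Rightarrow> 'd::{banach, second_countable_topology}"
  assumes [measurable]: "F \<in> borel_measurable borel"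
    and "\<And>y. integrable lborel (\<lambda>x. F (x, y))"
    and "\<And>y. (LINT x|lborel. norm (F (x, y))) \<le> k y" "integrable lborel k"
  shows "integrable lborel F"
proof -
  have "integrable lborel (\<lambda>p. F (snd p, fst p))"
    by (rule integrable_lborel_pairI[where k=k]) (use assms in \<open>simp_all add: borel_prod[symmetric]\<close>)
  then have "integrable (lborel \<Otimes>\<^sub>M lborel) (\<lambda>p. F (snd p, fst p))"
    by (simp add: lborel_prod)
  from lborel_pair.integrable_product_swap[OF this] show ?thesis
    by (simp add: lborel_prod case_prod_unfold)
qed

section \<open>Moyal's identity\<close>

text \<open>This is \<pi>(z) g: translation followed by modulation. It turns the transform at
  \<open>z\<close> into an inner product.\<close>

definition tf_shift :: "('a::euclidean_space \<Rightarrow> complex) \<Rightarrow> 'a \<times> 'a \<Rightarrow> 'a \<Rightarrow> complex" where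
  "tf_shift g z t = g (t - fst z) * exp (2 * of_real pi * \<i> * of_real (snd z \<bullet> t))"

lemma cnj_ft_char: "cnj (ft_char s) = exp (2 * of_real pi * \<i> * of_real s)"
  by (simp add: exp_cnj)

lemma tf_shift_eq: "tf_shift g z t = g (t - fst z) * cnj (ft_char (snd z \<bullet> t))"
  by (simp only: tf_shift_def cnj_ft_char)

lemma cmod_tf_shift: "cmod (tf_shift g z t) = cmod (g (t - fst z))"
  by (simp only: tf_shift_eq norm_mult complex_mod_cnj norm_ft_char mult_1_right)

lemma tf_shift_L2:
  assumes "g \<in> L2" shows "tf_shift g z \<in> L2"
proof (rule L2I)
  note [measurable] = L2_measurable[OF assms]
  show "tf_shift g z \<in> borel_measurable borel"
    unfolding tf_shift_def by measurable
  show "integrable lborel (\<lambda>t. (cmod (tf_shift g z t))\<^sup>2)"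
    using L2_integrable[OF L2_shift[OF assms]] by (simp add: cmod_tf_shift)
qed

lemma L2_norm_tf_shift: "g \<in> L2 \<Longrightarrow> L2_norm (tf_shift g z) = L2_norm g"
  using L2_norm_shift[of g "fst z"] by (simp add: L2_norm_def cmod_tf_shift)

lemma stft_eq: "stft g f z = (LINT t|lborel. f t * cnj (g (t - fst z)) * ft_char (snd z \<bullet> t))"
  by (simp add: stft_def case_prod_unfold)

lemma stft_eq_inner: "stft g f z = L2_inner f (tf_shift g z)"
proof -
  have "f t * cnj (g (t - fst z)) * ft_char (snd z \<bullet> t) = f t * cnj (tf_shift g z t)" for t
    by (simp only: tf_shift_eq complex_cnj_mult complex_cnj_cnj mult.assoc)
  then show ?thesis by (simp only: stft_eq L2_inner_def)
qed

lemma stft_measurable [measurable]: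
  fixes f g :: "'a::euclidean_space \<Rightarrow> complex"
  assumes [measurable]: "f \<in> borel_measurable borel" "g \<in> borel_measurable borel"
  shows "stft g f \<in> borel_measurable borel"
  unfolding stft_eq[abs_def] by measurable

lemma cmod_stft_le:
  "f \<in> L2 \<Longrightarrow> g \<in> L2 \<Longrightarrow> cmod (stft g f z) \<le> L2_norm f * L2_norm g"
  using L2_Cauchy_Schwarz[of f "tf_shift g z"] by (simp add: stft_eq_inner tf_shift_L2 L2_norm_tf_shift)

text \<open>The autocorrelation makes a Plancherel theorem dispensable: integrated over x, the
  weighted frequency integral of |V_g f|^2 becomes an integral of the autocorrelations of
  \<open>f\<close> and \<open>g\<close> against a Gaussian that concentrates at 0, where they take
  the squared norms as values.\<close>

definition autocorr :: "('b::euclidean_space \<Rightarrow> complex) \<Rightarrow> 'b \<Rightarrow> complex" where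
  "autocorr f u = (LINT t|lborel. f (t + u) * cnj (f t))"

lemma autocorr_measurable [measurable]:
  assumes [measurable]: "f \<in> borel_measurable borel"
  shows "autocorr f \<in> borel_measurable borel"
  unfolding autocorr_def[abs_def] by measurable

lemma L2_plus: "f \<in> L2 \<Longrightarrow> (\<lambda>t. f (t + u)) \<in> L2" "f \<in> L2 \<Longrightarrow> L2_norm (\<lambda>t. f (t + u)) = L2_norm f"
  using L2_shift[of f "-u"] L2_norm_shift[of f "-u"] by simp_all

lemma autocorr_eq_inner: "autocorr f u = L2_inner (\<lambda>t. f (t + u)) f"
  by (simp add: autocorr_def L2_inner_def)

lemma cmod_autocorr_le: "f \<in> L2 \<Longrightarrow> cmod (autocorr f u) \<le> (L2_norm f)\<^sup>2"
  using L2_Cauchy_Schwarz[of "\<lambda>t. f (t + u)" f] by (simp add: autocorr_eq_inner L2_plus power2_eq_square)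

lemma autocorr_0: "autocorr f 0 = of_real ((L2_norm f)\<^sup>2)"
  by (simp only: autocorr_eq_inner add_0_right L2_inner_self)

lemma autocorr_tendsto:
  assumes f: "f \<in> L2" and u: "u \<longlonglongrightarrow> 0"
  shows "(\<lambda>n::nat. autocorr f (u n)) \<longlonglongrightarrow> of_real ((L2_norm f)\<^sup>2)"
proof -
  have "(\<lambda>n. - u n) \<longlonglongrightarrow> 0" using tendsto_minus[OF u] by simp
  from L2_shift_tendsto[OF f this]
  have "(\<lambda>n. sqrt ((L2_norm (\<lambda>t. f (t + u n) - f t))\<^sup>2) * L2_norm f) \<longlonglongrightarrow> sqrt 0 * L2_norm f"
    by (intro tendsto_intros) simp
  then have lim: "(\<lambda>n. L2_norm (\<lambda>t. f (t + u n) - f t) * L2_norm f) \<longlonglongrightarrow> 0"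
    by (simp add: L2_norm_nonneg)
  have "cmod (autocorr f (u n) - autocorr f 0) \<le> L2_norm (\<lambda>t. f (t + u n) - f t) * L2_norm f" for n
    using L2_Cauchy_Schwarz[OF L2_diff[OF L2_plus(1)[OF f] f] f, of "u n"]
    by (simp add: autocorr_eq_inner L2_inner_diff_left L2_plus(1) f)
  then have "(\<lambda>n. autocorr f (u n) - autocorr f 0) \<longlonglongrightarrow> 0"
    by (intro Lim_null_comparison[OF _ lim]) simp
  then show ?thesis
    by (simp add: LIM_zero_iff autocorr_0)
qed

lemma ft_char_diff: "ft_char (a - b) = ft_char a * cnj (ft_char b)"
  unfolding cnj_ft_char by (simp only: exp_add[symmetric] of_real_diff) (simp add: algebra_simps)

text \<open>The square of the Fourier integral is a double integral; in the difference variable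
  \<open>fst p\<close> it is a Fourier integral again, and the weight can be integrated against the
  character. Integrability of \<open>F\<close> and \<open>w\<close> justifies the exchange. The pair
  (u, t) stays one variable \<open>p\<close>, so that a further integration can later be exchanged
  with it.\<close>

lemma fourier_square_weighted:
  fixes F :: "'b::euclidean_space \<Rightarrow> complex" and w :: "'b \<Rightarrow> real"
  assumes F: "integrable lborel F" and w: "integrable lborel w"
  shows "of_real (LINT \<xi>|lborel. (cmod (LINT t|lborel. F t * ft_char (\<xi> \<bullet> t)))\<^sup>2 * w \<xi>) =
    (LINT p|lborel. (LINT \<xi>|lborel. of_real (w \<xi>) * ft_char (\<xi> \<bullet> fst p)) *
       (F (snd p + fst p) * cnj (F (snd p))))"
proof -
  note [measurable] = F[THEN borel_measurable_integrable, simplified] w[THEN borel_measurable_integrable, simplified]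
  define Fh where "Fh \<xi> = (LINT t|lborel. F t * ft_char (\<xi> \<bullet> t))" for \<xi>
  define P where "P p = F (snd p + fst p) * cnj (F (snd p))" for p
  have [measurable]: "P \<in> borel_measurable borel"
    unfolding P_def by measurable
  have iF: "integrable lborel (\<lambda>t. F (t + u))" for u
    using F by (subst integrable_lborel_plus) simp_all
  have iF': "integrable lborel (\<lambda>u. F (t + u))" for t
    using iF[of t] by (simp add: add.commute)
  have P: "integrable lborel P"
  proof (rule integrable_lborel_pairI'[where k="\<lambda>t. (LINT u|lborel. cmod (F u)) * cmod (F t)"])
    show "integrable lborel (\<lambda>u. P (u, t))" for t
      unfolding P_def using iF' by simp
    show "(LINT u|lborel. norm (P (u, t))) \<le> (LINT u|lborel. cmod (F u)) * cmod (F t)" for t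
      using integral_lborel_plus[of "\<lambda>u. cmod (F u)" t] by (simp add: P_def norm_mult add.commute)
  qed (use F in auto)
  have Pw: "integrable lborel (\<lambda>p. ft_char (\<xi> \<bullet> fst p) * P p)" for \<xi>
    using P by (subst integrable_norm_iff[symmetric]) (simp_all add: norm_mult)
  have inner: "(LINT p|lborel. ft_char (\<xi> \<bullet> fst p) * P p) = of_real ((cmod (Fh \<xi>))\<^sup>2)" for \<xi>
  proof -
    have "(LINT p|lborel. ft_char (\<xi> \<bullet> fst p) * P p) =
        (LINT t|lborel. LINT u|lborel. ft_char (\<xi> \<bullet> u) * (F (t + u) * cnj (F t)))"
      by (subst integral_lborel_pair_snd[OF Pw]) (simp add: P_def)
    also have "\<dots> = (LINT t|lborel. cnj (F t * ft_char (\<xi> \<bullet> t)) * Fh \<xi>)"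
    proof (rule Bochner_Integration.integral_cong[OF refl])
      fix t
      \<comment> \<open>Shifting u by -t separates the variables: F (t + u) becomes F u and the
        character splits into a factor in t and one in u.\<close>
      have "(LINT u|lborel. ft_char (\<xi> \<bullet> u) * (F (t + u) * cnj (F t))) =
          (LINT u|lborel. ft_char (\<xi> \<bullet> (u - t)) * (F (t + (u - t)) * cnj (F t)))"
        by (rule integral_lborel_shift[symmetric]) measurable
      also have "\<dots> = (LINT u|lborel. (cnj (F t) * cnj (ft_char (\<xi> \<bullet> t))) * (F u * ft_char (\<xi> \<bullet> u)))"
      proof (rule Bochner_Integration.integral_cong[OF refl])
        fix u
        have "t + (u - t) = u" by simp
        then show "ft_char (\<xi> \<bullet> (u - t)) * (F (t + (u - t)) * cnj (F t)) =
            (cnj (F t) * cnj (ft_char (\<xi> \<bullet> t))) * (F u * ft_char (\<xi> \<bullet> u))"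
          by (simp only: inner_diff_right ft_char_diff) (simp only: mult_ac)
      qed
      also have "\<dots> = (cnj (F t) * cnj (ft_char (\<xi> \<bullet> t))) * Fh \<xi>"
        unfolding Fh_def by (rule integral_mult_right_zero)
      finally show "(LINT u|lborel. ft_char (\<xi> \<bullet> u) * (F (t + u) * cnj (F t))) =
          cnj (F t * ft_char (\<xi> \<bullet> t)) * Fh \<xi>"
        by (simp only: complex_cnj_mult)
    qed
    also have "\<dots> = (LINT t|lborel. cnj (F t * ft_char (\<xi> \<bullet> t))) * Fh \<xi>"
      by (rule integral_mult_left_zero)
    also have "\<dots> = cnj (Fh \<xi>) * Fh \<xi>"
      unfolding Fh_def by (simp only: Bochner_Integration.integral_cnj)
    finally show ?thesis
      unfolding complex_norm_square mult.commute[of "cnj (Fh \<xi>)"] .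
  qed
  define K where "K = (\<lambda>(\<xi>, p). of_real (w \<xi>) * (ft_char (\<xi> \<bullet> fst p) * P p))"
  have K: "integrable lborel K"
  proof (rule integrable_lborel_pairI[where k="\<lambda>\<xi>. \<bar>w \<xi>\<bar> * (LINT p|lborel. cmod (P p))"])
    show "K \<in> borel_measurable borel"
      unfolding K_def case_prod_unfold by measurable
    show "integrable lborel (\<lambda>p. K (\<xi>, p))" for \<xi>
      unfolding K_def using Pw by simp
    show "(LINT p|lborel. norm (K (\<xi>, p))) \<le> \<bar>w \<xi>\<bar> * (LINT p|lborel. cmod (P p))" for \<xi>
      by (simp add: K_def norm_mult)
  qed (use w in auto)
  have "of_real (LINT \<xi>|lborel. (cmod (Fh \<xi>))\<^sup>2 * w \<xi>) = (LINT \<xi>|lborel. complex_of_real (w \<xi>) * of_real ((cmod (Fh \<xi>))\<^sup>2))"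
    unfolding integral_complex_of_real[symmetric]
    by (rule Bochner_Integration.integral_cong) (simp_all add: mult.commute)
  also have "\<dots> = (LINT \<xi>|lborel. LINT p|lborel. K (\<xi>, p))"
    by (simp add: K_def inner)
  also have "\<dots> = (LINT p|lborel. LINT \<xi>|lborel. K (\<xi>, p))"
    using integral_lborel_pair_fst[OF K] integral_lborel_pair_snd[OF K] by simp
  also have "\<dots> = (LINT p|lborel. (LINT \<xi>|lborel. of_real (w \<xi>) * ft_char (\<xi> \<bullet> fst p)) * P p)"
    by (simp add: K_def mult.assoc[symmetric])
  finally show ?thesis by (simp add: Fh_def P_def)
qed

lemma autocorr_reflect:
  assumes [measurable]: "g \<in> borel_measurable borel"
  shows "(LINT x|lborel. cnj (g (t + u - x)) * g (t - x)) = cnj (autocorr g u)"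
proof -
  have "(LINT x|lborel. cnj (g (t + u - x)) * g (t - x)) = (LINT x|lborel. cnj (g ((t - x) + u) * cnj (g (t - x))))"
    by (simp add: algebra_simps)
  also have "\<dots> = (LINT x|lborel. cnj (g (x + u) * cnj (g x)))"
    by (rule integral_lborel_reflect[of "\<lambda>x. cnj (g (x + u) * cnj (g x))"]) measurable
  also have "\<dots> = cnj (autocorr g u)"
    unfolding autocorr_def by (rule Bochner_Integration.integral_cnj)
  finally show ?thesis .
qed

text \<open>For fixed x, the transform is the Fourier integral of t -> f t * cnj (g (t - x)), which
  is in L1, so the weighted formula applies. Integrating over x produces the autocorrelation of
  \<open>g\<close>. Rescaling u by 1/c then moves the width of the Gaussian into the arguments of
  the autocorrelations and leaves a weight that does not depend on \<open>c\<close>.\<close>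

lemma stft_weighted_norm:
  fixes f g :: "'a::euclidean_space \<Rightarrow> complex"
  assumes f: "f \<in> L2" and g: "g \<in> L2" and c: "c > 0"
  defines "Q \<equiv> LINT u|lborel. of_real (gauss u) * (autocorr f (u /\<^sub>R c) * cnj (autocorr g (u /\<^sub>R c)))"
  shows "(\<integral>\<^sup>+z. ennreal ((cmod (stft g f z))\<^sup>2 * gauss (snd z /\<^sub>R c)) \<partial>lborel) = ennreal (Re Q)"
proof -
  note [measurable] = f[THEN L2_measurable] g[THEN L2_measurable]
  \<comment> \<open>The Fourier transform of the weight in \<open>\<xi>\<close>, an approximate
    identity as \<open>c\<close> grows.\<close>
  define \<Gamma> :: "'a \<Rightarrow> real" where "\<Gamma> u = c ^ DIM('a) * gauss (c *\<^sub>R u)" for u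
  have [measurable]: "\<Gamma> \<in> borel_measurable borel" unfolding \<Gamma>_def by measurable
  have \<Gamma>0: "0 \<le> \<Gamma> u" for u using c by (simp add: \<Gamma>_def gauss_nonneg)
  have \<Gamma>: "integrable lborel \<Gamma>"
    unfolding \<Gamma>_def using integrable_lborel_affine_iff[of c "gauss :: 'a \<Rightarrow> real" 0] c
    by (simp add: gauss_integrable)
  define D where "D p = f (snd p + fst p) * cnj (f (snd p))" for p
  define W where "W = (\<lambda>(p, x). of_real (\<Gamma> (fst p)) * (D p * (cnj (g (snd p + fst p - x)) * g (snd p - x))))"
  define J where "J x = (LINT \<xi>|lborel. (cmod (stft g f (x, \<xi>)))\<^sup>2 * gauss (\<xi> /\<^sub>R c))" for x
  have [measurable]: "D \<in> borel_measurable borel" unfolding D_def by measurable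
  have abs_corr: "integrable lborel (\<lambda>t. cmod (h (t + u)) * cmod (h t))"
      "(LINT t|lborel. cmod (h (t + u)) * cmod (h t)) \<le> (L2_norm h)\<^sup>2"
      if "h \<in> L2" for h :: "'a \<Rightarrow> complex" and u
  proof -
    show "integrable lborel (\<lambda>t. cmod (h (t + u)) * cmod (h t))"
      using integrable_norm[OF L2_inner_integrable[OF L2_plus(1)[OF that] that]] by (simp add: norm_mult)
    show "(LINT t|lborel. cmod (h (t + u)) * cmod (h t)) \<le> (L2_norm h)\<^sup>2"
      using L2_Cauchy_Schwarz_abs[OF L2_plus(1)[OF that] that] by (simp add: L2_plus that power2_eq_square)
  qed
  have g_corr: "integrable lborel (\<lambda>x. cmod (g (t + u - x)) * cmod (g (t - x)))"
      "(LINT x|lborel. cmod (g (t + u - x)) * cmod (g (t - x))) \<le> (L2_norm g)\<^sup>2" for t u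
    using abs_corr[OF g, of u] integrable_lborel_reflect[of "\<lambda>x. cmod (g (x + u)) * cmod (g x)" t]
      integral_lborel_reflect[of "\<lambda>x. cmod (g (x + u)) * cmod (g x)" t]
    by (simp_all add: algebra_simps)
  have iD: "integrable lborel (\<lambda>p. of_real (\<Gamma> (fst p)) * D p)"
  proof (rule integrable_lborel_pairI[where k="\<lambda>u. \<Gamma> u * (L2_norm f)\<^sup>2"])
    show "integrable lborel (\<lambda>t. of_real (\<Gamma> (fst (u, t))) * D (u, t))" for u
      using L2_inner_integrable[OF L2_plus(1)[OF f] f] by (simp add: D_def)
    show "(LINT t|lborel. norm (of_real (\<Gamma> (fst (u, t))) * D (u, t))) \<le> \<Gamma> u * (L2_norm f)\<^sup>2" for u
      using abs_corr(2)[OF f, of u] by (simp add: D_def norm_mult \<Gamma>0 mult_left_mono)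
  qed (use \<Gamma> in auto)
  have W: "integrable lborel W"
  proof (rule integrable_lborel_pairI[where k="\<lambda>p. norm (of_real (\<Gamma> (fst p)) * D p) * (L2_norm g)\<^sup>2"])
    show "W \<in> borel_measurable borel"
      unfolding W_def case_prod_unfold by measurable
    show "integrable lborel (\<lambda>x. W (p, x))" for p
      using g_corr(1)[of "snd p" "fst p"]
      by (subst integrable_norm_iff[symmetric]) (auto simp: W_def norm_mult)
    show "(LINT x|lborel. norm (W (p, x))) \<le> norm (of_real (\<Gamma> (fst p)) * D p) * (L2_norm g)\<^sup>2" for p
      using mult_left_mono[OF g_corr(2)[of "snd p" "fst p"], of "norm (of_real (\<Gamma> (fst p)) * D p)"]
      by (simp add: W_def norm_mult mult.assoc)
  qed (use iD in auto)
  have J: "of_real (J x) = (LINT p|lborel. W (p, x))" for x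
  proof -
    have F: "integrable lborel (\<lambda>t. f t * cnj (g (t - x)))"
      by (rule L2_inner_integrable[OF f L2_shift[OF g]])
    show ?thesis
      unfolding J_def stft_eq fst_conv snd_conv
        fourier_square_weighted[OF F gauss_dilate_integrable[OF c]] gauss_dilate_fourier[OF c]
      by (rule Bochner_Integration.integral_cong) (simp_all add: W_def D_def \<Gamma>_def mult_ac)
  qed
  have iJ: "integrable lborel J"
    using integrable_lborel_pair_snd[OF W] unfolding J[symmetric] by (simp add: complex_of_real_integrable_eq)
  have J0: "0 \<le> J x" for x
    unfolding J_def by (intro Bochner_Integration.integral_nonneg) (simp add: gauss_nonneg)
  have "complex_of_real (LINT x|lborel. J x) = (LINT x|lborel. LINT p|lborel. W (p, x))"
    by (simp add: J[symmetric])
  also have "\<dots> = (LINT p|lborel. LINT x|lborel. W (p, x))"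
    using integral_lborel_pair_fst[OF W] integral_lborel_pair_snd[OF W] by simp
  also have "\<dots> = (LINT p|lborel. of_real (\<Gamma> (fst p)) * (D p * cnj (autocorr g (fst p))))"
    by (simp add: W_def autocorr_reflect)
  also have "\<dots> = (LINT u|lborel. LINT t|lborel. of_real (\<Gamma> u) * (D (u, t) * cnj (autocorr g u)))"
  proof (subst integral_lborel_pair_fst)
    show "integrable lborel (\<lambda>p. of_real (\<Gamma> (fst p)) * (D p * cnj (autocorr g (fst p))))"
      using integrable_lborel_pair_fst[OF W] by (simp add: W_def autocorr_reflect)
  qed simp
  also have "\<dots> = (LINT u|lborel. of_real (\<Gamma> u) * (autocorr f u * cnj (autocorr g u)))"
    by (simp add: D_def autocorr_def[of f])
  also have "\<dots> = Q"
    unfolding Q_def using c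
    by (subst (2) integral_lborel_affine[of c _ 0]) (simp_all add: \<Gamma>_def scaleR_conv_of_real mult.assoc)
  finally have Q: "(LINT x|lborel. J x) = Re Q"
    by (metis Re_complex_of_real)
  have "(\<integral>\<^sup>+z. ennreal ((cmod (stft g f z))\<^sup>2 * gauss (snd z /\<^sub>R c)) \<partial>lborel) =
      (\<integral>\<^sup>+x. \<integral>\<^sup>+\<xi>. ennreal ((cmod (stft g f (x, \<xi>)))\<^sup>2 * gauss (\<xi> /\<^sub>R c)) \<partial>lborel \<partial>lborel)"
    by (subst nn_integral_lborel_pair_fst) simp_all
  also have "\<dots> = (\<integral>\<^sup>+x. ennreal (J x) \<partial>lborel)"
  proof (rule nn_integral_cong)
    fix x
    have "integrable lborel (\<lambda>\<xi>. (cmod (stft g f (x, \<xi>)))\<^sup>2 * gauss (\<xi> /\<^sub>R c))"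
    proof (rule Bochner_Integration.integrable_bound)
      show "integrable lborel (\<lambda>\<xi>::'a. (L2_norm f * L2_norm g)\<^sup>2 * gauss (\<xi> /\<^sub>R c))"
        by (intro integrable_mult_right gauss_dilate_integrable[OF c])
      show "(\<lambda>\<xi>. (cmod (stft g f (x, \<xi>)))\<^sup>2 * gauss (\<xi> /\<^sub>R c)) \<in> borel_measurable lborel"
        unfolding stft_eq fst_conv snd_conv by measurable
      show "AE \<xi> in lborel. norm ((cmod (stft g f (x, \<xi>)))\<^sup>2 * gauss (\<xi> /\<^sub>R c)) \<le>
          norm ((L2_norm f * L2_norm g)\<^sup>2 * gauss (\<xi> /\<^sub>R c))"
        using cmod_stft_le[OF f g] by (auto simp: abs_mult gauss_nonneg intro!: mult_right_mono power_mono)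
    qed
    then show "(\<integral>\<^sup>+\<xi>. ennreal ((cmod (stft g f (x, \<xi>)))\<^sup>2 * gauss (\<xi> /\<^sub>R c)) \<partial>lborel) = ennreal (J x)"
      unfolding J_def by (rule nn_integral_eq_integral) (simp add: gauss_nonneg)
  qed
  also have "\<dots> = ennreal (Re Q)"
    using iJ J0 Q by (simp add: nn_integral_eq_integral)
  finally show ?thesis .
qed

text \<open>The Gaussian weight in \<open>\<xi>\<close> makes Fubini applicable and is then removed by
  monotone convergence on the phase space side and by dominated convergence on the side of the
  autocorrelations.\<close>

theorem nn_integral_stft_square:
  fixes f g :: "'a::euclidean_space \<Rightarrow> complex"
  assumes f: "f \<in> L2" and g: "g \<in> L2"
  shows "(\<integral>\<^sup>+z. ennreal ((cmod (stft g f z))\<^sup>2) \<partial>lborel) = ennreal ((L2_norm f)\<^sup>2 * (L2_norm g)\<^sup>2)"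
proof -
  note [measurable] = f[THEN L2_measurable] g[THEN L2_measurable]
  define Q where "Q n = (LINT u|lborel. of_real (gauss u) *
      (autocorr f (u /\<^sub>R real (Suc n)) * cnj (autocorr g (u /\<^sub>R real (Suc n)))))" for n
  have null: "(\<lambda>n. u /\<^sub>R real (Suc n)) \<longlonglongrightarrow> 0" for u :: 'a
    using tendsto_scaleR[OF LIMSEQ_inverse_real_of_nat tendsto_const[of u]] by simp
  have "Q \<longlonglongrightarrow> (LINT u|lborel. of_real (gauss (u::'a)) * (of_real ((L2_norm f)\<^sup>2) * cnj (of_real ((L2_norm g)\<^sup>2))))"
    unfolding Q_def
  proof (rule integral_dominated_convergence[where w="\<lambda>u. gauss u * ((L2_norm f)\<^sup>2 * (L2_norm g)\<^sup>2)"])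
    show "AE u in lborel. (\<lambda>n. of_real (gauss u) * (autocorr f (u /\<^sub>R real (Suc n)) * cnj (autocorr g (u /\<^sub>R real (Suc n)))))
        \<longlonglongrightarrow> of_real (gauss u) * (of_real ((L2_norm f)\<^sup>2) * cnj (of_real ((L2_norm g)\<^sup>2)))"
      by (intro AE_I2 tendsto_intros autocorr_tendsto[OF f null] autocorr_tendsto[OF g null])
    show "AE u in lborel. norm (of_real (gauss u) * (autocorr f (u /\<^sub>R real (Suc n)) * cnj (autocorr g (u /\<^sub>R real (Suc n)))))
        \<le> gauss u * ((L2_norm f)\<^sup>2 * (L2_norm g)\<^sup>2)" for n
      using cmod_autocorr_le[OF f] cmod_autocorr_le[OF g]
      by (auto simp: norm_mult gauss_nonneg intro!: mult_left_mono mult_mono)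
  qed (use gauss_integrable in auto)
  then have "Q \<longlonglongrightarrow> of_real ((L2_norm f)\<^sup>2 * (L2_norm g)\<^sup>2)"
    by (simp add: gauss_integral del: of_real_power)
  then have "(\<lambda>n. ennreal (Re (Q n))) \<longlonglongrightarrow> ennreal ((L2_norm f)\<^sup>2 * (L2_norm g)\<^sup>2)"
    by (intro tendsto_ennrealI) (metis Re_complex_of_real tendsto_Re)
  moreover have "(\<lambda>n. ennreal (Re (Q n))) \<longlonglongrightarrow> (\<integral>\<^sup>+z. ennreal ((cmod (stft g f z))\<^sup>2) \<partial>lborel)"
  proof -
    have "(\<lambda>n. \<integral>\<^sup>+z. ennreal ((cmod (stft g f z))\<^sup>2 * gauss (snd z /\<^sub>R real (Suc n))) \<partial>lborel)
        \<longlonglongrightarrow> (\<integral>\<^sup>+z. ennreal ((cmod (stft g f z))\<^sup>2) \<partial>lborel)"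
    proof (rule nn_integral_LIMSEQ)
      show "incseq (\<lambda>n z. ennreal ((cmod (stft g f z))\<^sup>2 * gauss (snd z /\<^sub>R real (Suc n))))"
      proof (intro incseq_SucI le_funI ennreal_leI mult_left_mono)
        fix n :: nat and z :: "'a \<times> 'a"
        have "norm (snd z) / real (Suc (Suc n)) \<le> norm (snd z) / real (Suc n)"
          by (intro divide_left_mono) auto
        then have "(norm (snd z) / real (Suc (Suc n)))\<^sup>2 \<le> (norm (snd z) / real (Suc n))\<^sup>2"
          by (intro power_mono) auto
        then show "gauss (snd z /\<^sub>R real (Suc n)) \<le> gauss (snd z /\<^sub>R real (Suc (Suc n)))"
          by (simp add: gauss_def divide_inverse mult.commute)
      qed simp
      show "(\<lambda>n. ennreal ((cmod (stft g f z))\<^sup>2 * gauss (snd z /\<^sub>R real (Suc n)))) \<longlonglongrightarrow> ennreal ((cmod (stft g f z))\<^sup>2)" for z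
      proof (rule tendsto_ennrealI)
        have "(\<lambda>n. (cmod (stft g f z))\<^sup>2 * gauss (snd z /\<^sub>R real (Suc n))) \<longlonglongrightarrow> (cmod (stft g f z))\<^sup>2 * exp (- pi * (norm (0::'a))\<^sup>2)"
          unfolding gauss_def by (intro tendsto_intros null)
        then show "(\<lambda>n. (cmod (stft g f z))\<^sup>2 * gauss (snd z /\<^sub>R real (Suc n))) \<longlonglongrightarrow> (cmod (stft g f z))\<^sup>2"
          by simp
      qed
    qed measurable
    then show ?thesis
      unfolding stft_weighted_norm[OF f g of_nat_0_less_iff[THEN iffD2, OF zero_less_Suc]] Q_def .
  qed
  ultimately show ?thesis
    by (rule LIMSEQ_unique[symmetric])
qed

lemma stft_L2:
  assumes f: "f \<in> L2" and g: "g \<in> L2"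
  shows "stft g f \<in> L2" "L2_norm (stft g f) = L2_norm f * L2_norm g"
proof -
  note [measurable] = f[THEN L2_measurable] g[THEN L2_measurable]
  have nn: "(\<integral>\<^sup>+z. ennreal ((cmod (stft g f z))\<^sup>2) \<partial>lborel) = ennreal ((L2_norm f * L2_norm g)\<^sup>2)"
    using nn_integral_stft_square[OF assms] by (simp add: power_mult_distrib)
  show i: "stft g f \<in> L2"
    by (rule L2I) (use nn in \<open>auto simp: integrable_iff_bounded\<close>)
  show "L2_norm (stft g f) = L2_norm f * L2_norm g"
    using nn nn_integral_L2_norm[OF i] by (simp add: L2_norm_nonneg power2_eq_iff_nonneg)
qed

section \<open>Continuity of time-frequency shifts\<close>

lemma tf_shift_measurable [measurable (raw)]:
  assumes [measurable]: "g \<in> borel_measurable borel" "z \<in> borel_measurable M" "t \<in> borel_measurable M"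
  shows "(\<lambda>w. tf_shift g (z w) (t w)) \<in> borel_measurable M"
  unfolding tf_shift_def by measurable

text \<open>The difference splits into a translation part, whose unimodular factor does not affect
  the norm, and a modulation part on a fixed translate. The former tends to 0 by continuity of
  translations in L2, the latter by dominated convergence; its majorant 4 |G|^2 reflects that two
  unimodular numbers differ by at most 2.\<close>

lemma tf_shift_tendsto:
  assumes g: "g \<in> L2" and z: "z \<longlonglongrightarrow> w"
  shows "(\<lambda>n::nat. (L2_norm (\<lambda>t. tf_shift g (z n) t - tf_shift g w t))\<^sup>2) \<longlonglongrightarrow> 0"
proof -
  note [measurable] = L2_measurable[OF g]
  let ?G = "\<lambda>t. g (t - fst w)"
  let ?e = "\<lambda>n t. cnj (ft_char (snd (z n) \<bullet> t)) - cnj (ft_char (snd w \<bullet> t))"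
  let ?a = "\<lambda>n t. (g (t - fst (z n)) - ?G t) * cnj (ft_char (snd (z n) \<bullet> t))"
  let ?b = "\<lambda>n t. ?G t * ?e n t"
  have G: "?G \<in> L2" by (rule L2_shift[OF g])
  have e: "cmod (?e n t) \<le> 2" for n t
    using norm_triangle_ineq4[of "cnj (ft_char (snd (z n) \<bullet> t))" "cnj (ft_char (snd w \<bullet> t))"]
    unfolding complex_mod_cnj norm_ft_char by simp
  have a_norm: "cmod (?a n t) = cmod (g (t - fst (z n)) - ?G t)" for n t
    unfolding norm_mult complex_mod_cnj norm_ft_char by simp
  have b_norm: "(cmod (?b n t))\<^sup>2 \<le> 4 * (cmod (?G t))\<^sup>2" for n t
    using power_mono[OF mult_left_mono[OF e[of n t] norm_ge_zero[of "?G t"]], of 2]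
    by (simp add: norm_mult power_mult_distrib)
  have "?a n \<in> L2" for n
    using L2_integrable[OF L2_diff[OF L2_shift[OF g, of "fst (z n)"] G]]
    by (intro L2I) (simp_all add: a_norm)
  moreover have b: "?b n \<in> L2" for n
    using L2_integrable[OF G] b_norm by (intro L2_dominated[where k="\<lambda>t. 4 * (cmod (?G t))\<^sup>2"]) simp_all
  moreover have "tf_shift g (z n) t - tf_shift g w t = ?a n t + ?b n t" for n t
    unfolding tf_shift_eq by (simp only: left_diff_distrib right_diff_distrib) simp
  ultimately have le: "(L2_norm (\<lambda>t. tf_shift g (z n) t - tf_shift g w t))\<^sup>2
      \<le> 2 * (L2_norm (?a n))\<^sup>2 + 2 * (L2_norm (?b n))\<^sup>2" for n
    using L2_norm_add_square_le[of "?a n" "?b n"] by simp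
  have "(\<lambda>n. fst (z n) - fst w) \<longlonglongrightarrow> 0"
    using tendsto_fst[OF z] by (simp add: LIM_zero)
  from L2_shift_tendsto[OF G this] have "(\<lambda>n. (L2_norm (?a n))\<^sup>2) \<longlonglongrightarrow> 0"
    unfolding L2_norm_def a_norm by (simp add: algebra_simps)
  moreover have "(\<lambda>n. (L2_norm (?b n))\<^sup>2) \<longlonglongrightarrow> (LINT t|(lborel::'a measure). 0)"
    unfolding L2_norm_square
  proof (rule integral_dominated_convergence[where w="\<lambda>t. 4 * (cmod (?G t))\<^sup>2"])
    show "AE t in lborel. (\<lambda>n. (cmod (?b n t))\<^sup>2) \<longlonglongrightarrow> 0"
    proof (rule AE_I2)
      fix t
      have "(\<lambda>n. (cmod (?b n t))\<^sup>2) \<longlonglongrightarrow> (cmod (?G t * (cnj (ft_char (snd w \<bullet> t)) - cnj (ft_char (snd w \<bullet> t)))))\<^sup>2"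
        by (intro tendsto_intros z)
      then show "(\<lambda>n. (cmod (?b n t))\<^sup>2) \<longlonglongrightarrow> 0" by simp
    qed
    show "AE t in lborel. norm ((cmod (?b n t))\<^sup>2) \<le> 4 * (cmod (?G t))\<^sup>2" for n
      using b_norm by (intro AE_I2) simp
  qed (use L2_integrable[OF G] in auto)
  ultimately have "(\<lambda>n. 2 * (L2_norm (?a n))\<^sup>2 + 2 * (L2_norm (?b n))\<^sup>2) \<longlonglongrightarrow> 2 * 0 + 2 * 0"
    by (intro tendsto_intros) simp_all
  then have lim: "(\<lambda>n. 2 * (L2_norm (?a n))\<^sup>2 + 2 * (L2_norm (?b n))\<^sup>2) \<longlonglongrightarrow> 0"
    by simp
  show ?thesis
    by (rule tendsto_sandwich[OF _ _ tendsto_const lim]) (use le in simp_all)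
qed

text \<open>The epsilon-delta form matches the equicontinuity condition of the Arzela-Ascoli
  theorem: by Cauchy-Schwarz one \<open>d\<close> serves all transforms of functions in the unit
  ball.\<close>

lemma tf_shift_continuous:
  assumes g: "g \<in> L2" and e: "e > 0"
  shows "\<exists>d>0. \<forall>w. norm (z - w) < d \<longrightarrow> L2_norm (\<lambda>t. tf_shift g z t - tf_shift g w t) < e"
proof -
  define \<Phi> where "\<Phi> w = (L2_norm (\<lambda>t. tf_shift g w t - tf_shift g z t))\<^sup>2" for w
  have "\<Phi> z = 0" by (simp add: \<Phi>_def L2_norm_def)
  then have "isCont \<Phi> z"
    unfolding continuous_at_sequentially using tf_shift_tendsto[OF g] by (auto simp: \<Phi>_def o_def)
  then obtain d where d: "d > 0" "\<And>w. dist w z < d \<Longrightarrow> dist (\<Phi> w) (\<Phi> z) < e\<^sup>2"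
    unfolding continuous_at_eps_delta using e by (metis zero_less_power)
  have "L2_norm (\<lambda>t. tf_shift g z t - tf_shift g w t) < e" if "norm (z - w) < d" for w
  proof -
    have "\<Phi> w < e\<^sup>2"
      using d(2)[of w] that \<open>\<Phi> z = 0\<close> by (simp add: dist_norm norm_minus_commute \<Phi>_def)
    then have "L2_norm (\<lambda>t. tf_shift g w t - tf_shift g z t) < e"
      using e unfolding \<Phi>_def by (intro power_less_imp_less_base[of _ 2 e]) simp_all
    then show ?thesis by (simp add: L2_norm_def norm_minus_commute)
  qed
  with d(1) show ?thesis by blast
qed

lemma cmod_stft_diff_le:
  assumes "f \<in> L2" "g \<in> L2"
  shows "cmod (stft g f z - stft g f w) \<le> L2_norm f * L2_norm (\<lambda>t. tf_shift g z t - tf_shift g w t)"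
  using L2_Cauchy_Schwarz[OF assms(1) L2_diff[OF tf_shift_L2[OF assms(2), of z] tf_shift_L2[OF assms(2), of w]]]
  by (simp add: stft_eq_inner L2_inner_diff_right tf_shift_L2 assms)

lemma stft_diff:
  assumes "f \<in> L2" "f' \<in> L2" "g \<in> L2"
  shows "stft g (\<lambda>t. f t - f' t) z = stft g f z - stft g f' z"
  by (simp add: stft_eq_inner L2_inner_diff_left tf_shift_L2 assms)

lemma stft_scale: "stft g (\<lambda>t. c * f t) z = c * stft g f z"
  by (simp add: stft_eq_inner L2_inner_scale_left)

section \<open>Localization operators\<close>

definition synth :: "('a::euclidean_space \<Rightarrow> complex) \<Rightarrow> ('a \<times> 'a) set \<Rightarrow> ('a \<times> 'a \<Rightarrow> complex) \<Rightarrow> 'a \<Rightarrow> complex" where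
  "synth g \<Omega> F t = (LINT z|lborel. indicat_real \<Omega> z *\<^sub>R (F z * tf_shift g z t))"

lemma loc_op_eq_synth: "loc_op g \<Omega> f = synth g \<Omega> (stft g f)"
  by (simp add: loc_op_def synth_def tf_shift_def set_lebesgue_integral_def case_prod_unfold mult.assoc fun_eq_iff)

lemma synth_cong: "(\<And>z. z \<in> \<Omega> \<Longrightarrow> F z = F' z) \<Longrightarrow> synth g \<Omega> F = synth g \<Omega> F'"
  unfolding synth_def by (intro ext Bochner_Integration.integral_cong) (auto simp: indicator_def)

lemma synth_scale: "synth g \<Omega> (\<lambda>z. c * F z) t = c * synth g \<Omega> F t"
  by (simp add: synth_def mult.assoc flip: mult_scaleR_right)

section \<open>Synthesis from bounded functions on \<Omega>\<close>

locale tf_window =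
  fixes g :: "'a::euclidean_space \<Rightarrow> complex" and \<Omega> :: "('a \<times> 'a) set"
  assumes g: "g \<in> L2" and g_norm: "L2_norm g = 1" and compact_\<Omega>: "compact \<Omega>"
begin

lemma g_measurable [measurable]: "g \<in> borel_measurable borel"
  by (rule L2_measurable[OF g])

lemma \<Omega>_borel [measurable]: "\<Omega> \<in> sets borel"
  using compact_\<Omega> by (rule borel_compact)

lemma \<Omega>_finite: "emeasure lborel \<Omega> < \<infinity>"
  using compact_\<Omega> by (rule emeasure_compact_finite)

lemma \<Omega>_emeasure: "emeasure lborel \<Omega> = ennreal (measure lborel \<Omega>)"
  using \<Omega>_finite by (intro emeasure_eq_ennreal_measure) simp

text \<open>The frequencies of \<Omega> lie in a ball, so the integral is at most ||g||^2 times the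
  volume of that ball. This yields finiteness for every t; finite measure of \<Omega> by itself
  would yield it for almost every t.\<close>

lemma nn_integral_window_slice: "(\<integral>\<^sup>+z. indicator \<Omega> z * ennreal ((cmod (g (t - fst z)))\<^sup>2) \<partial>lborel) < \<infinity>"
proof -
  have b: "bounded (snd ` \<Omega>)"
    using compact_\<Omega> by (intro compact_imp_bounded compact_continuous_image continuous_on_snd continuous_on_id)
  then obtain r where r: "snd ` \<Omega> \<subseteq> ball 0 r" by (metis bounded_subset_ballD)
  have [measurable]: "(\<lambda>z::'a \<times> 'a. indicator (ball (0::'a) r) (snd z) :: ennreal) \<in> borel_measurable borel"
    by (rule measurable_compose[OF _ borel_measurable_indicator])
      (auto intro!: borel_measurable_continuous_onI continuous_on_snd continuous_on_id)
  have "(\<integral>\<^sup>+z. indicator \<Omega> z * ennreal ((cmod (g (t - fst z)))\<^sup>2) \<partial>lborel) \<le>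
      (\<integral>\<^sup>+z. ennreal ((cmod (g (t - fst z)))\<^sup>2) * indicator (ball 0 r) (snd z) \<partial>(lborel :: ('a \<times> 'a) measure))"
    using r by (intro nn_integral_mono) (auto simp: indicator_def)
  also have "\<dots> = (\<integral>\<^sup>+x. \<integral>\<^sup>+\<xi>. ennreal ((cmod (g (t - x)))\<^sup>2) * indicator (ball 0 r) (\<xi>::'a) \<partial>lborel \<partial>lborel)"
    by (subst nn_integral_lborel_pair_fst) simp_all
  also have "\<dots> = (\<integral>\<^sup>+x. ennreal ((cmod (g (t - x)))\<^sup>2) \<partial>lborel) * emeasure lborel (ball (0::'a) r)"
    by (simp add: nn_integral_cmult_indicator nn_integral_multc)
  also have "(\<integral>\<^sup>+x. ennreal ((cmod (g (t - x)))\<^sup>2) \<partial>lborel) = ennreal ((L2_norm g)\<^sup>2)"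
    using nn_integral_lborel_reflect[of "\<lambda>x. ennreal ((cmod (g x))\<^sup>2)" t] by (simp add: nn_integral_L2_norm g)
  also have "\<dots> * emeasure lborel (ball (0::'a) r) < \<infinity>"
    using emeasure_lborel_ball_finite[of "0::'a" r] by (simp add: ennreal_mult_less_top)
  finally show ?thesis .
qed

text \<open>Cauchy-Schwarz against the indicator, which is its own square.\<close>

lemma window_slice_square:
  "(\<integral>\<^sup>+z. indicator \<Omega> z * ennreal (cmod (g (t - fst z))) \<partial>lborel)\<^sup>2 \<le>
     emeasure lborel \<Omega> * (\<integral>\<^sup>+z. indicator \<Omega> z * ennreal ((cmod (g (t - fst z)))\<^sup>2) \<partial>lborel)"
proof -
  have "(\<integral>\<^sup>+z. indicator \<Omega> z * (indicator \<Omega> z * ennreal (cmod (g (t - fst z)))) \<partial>lborel)\<^sup>2 \<le>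
     (\<integral>\<^sup>+z. (indicator \<Omega> z)\<^sup>2 \<partial>lborel) * (\<integral>\<^sup>+z. (indicator \<Omega> z * ennreal (cmod (g (t - fst z))))\<^sup>2 \<partial>lborel)"
    by (rule Cauchy_Schwarz_nn_integral) measurable
  moreover have "(indicator \<Omega> z)\<^sup>2 = (indicator \<Omega> z :: ennreal)" for z
    by (simp add: indicator_def)
  moreover have "indicator \<Omega> z * (indicator \<Omega> z * ennreal (cmod (g (t - fst z)))) =
      indicator \<Omega> z * ennreal (cmod (g (t - fst z)))" for z
    by (simp add: indicator_def)
  ultimately show ?thesis by (simp add: power_mult_distrib ennreal_power)
qed

lemma nn_integral_window:
  "(\<integral>\<^sup>+t. \<integral>\<^sup>+z. indicator \<Omega> z * ennreal ((cmod (g (t - fst z)))\<^sup>2) \<partial>lborel \<partial>lborel) = emeasure lborel \<Omega>"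
proof -
  have "(\<integral>\<^sup>+t. \<integral>\<^sup>+z. indicator \<Omega> z * ennreal ((cmod (g (t - fst z)))\<^sup>2) \<partial>lborel \<partial>lborel) =
      (\<integral>\<^sup>+p. indicator \<Omega> (fst p) * ennreal ((cmod (g (snd p - fst (fst p))))\<^sup>2) \<partial>lborel)"
    by (subst nn_integral_lborel_pair_snd) simp_all
  also have "\<dots> = (\<integral>\<^sup>+z. \<integral>\<^sup>+t. indicator \<Omega> z * ennreal ((cmod (g (t - fst z)))\<^sup>2) \<partial>lborel \<partial>lborel)"
    by (subst nn_integral_lborel_pair_fst) simp_all
  also have "\<dots> = (\<integral>\<^sup>+z. indicator \<Omega> z * ennreal ((L2_norm g)\<^sup>2) \<partial>lborel)"
    using nn_integral_lborel_shift[of "\<lambda>x. ennreal ((cmod (g x))\<^sup>2)"]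
    by (simp add: nn_integral_cmult nn_integral_L2_norm g)
  finally show ?thesis by (simp add: g_norm)
qed

context
  fixes F :: "'a \<times> 'a \<Rightarrow> complex" and C :: real
  assumes F [measurable]: "F \<in> borel_measurable borel" and C: "\<And>z. z \<in> \<Omega> \<Longrightarrow> cmod (F z) \<le> C" "0 \<le> C"
begin

lemma nn_integral_synth_le:
  "(\<integral>\<^sup>+z. ennreal (norm (indicat_real \<Omega> z *\<^sub>R (F z * tf_shift g z t))) \<partial>lborel) \<le>
     ennreal C * (\<integral>\<^sup>+z. indicator \<Omega> z * ennreal (cmod (g (t - fst z))) \<partial>lborel)"
proof -
  have "(\<integral>\<^sup>+z. ennreal (norm (indicat_real \<Omega> z *\<^sub>R (F z * tf_shift g z t))) \<partial>lborel) \<le>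
      (\<integral>\<^sup>+z. ennreal C * (indicator \<Omega> z * ennreal (cmod (g (t - fst z)))) \<partial>lborel)"
    using C by (intro nn_integral_mono)
      (auto simp: indicator_def norm_mult cmod_tf_shift simp flip: ennreal_mult intro!: ennreal_leI mult_right_mono)
  then show ?thesis by (simp add: nn_integral_cmult)
qed

lemma synth_integrable: "integrable lborel (\<lambda>z. indicat_real \<Omega> z *\<^sub>R (F z * tf_shift g z t))"
  unfolding integrable_iff_bounded
proof
  note window_slice_square[of t]
  also have "emeasure lborel \<Omega> * (\<integral>\<^sup>+z. indicator \<Omega> z * ennreal ((cmod (g (t - fst z)))\<^sup>2) \<partial>lborel) < \<infinity>"
    using nn_integral_window_slice[of t] \<Omega>_finite by (simp add: ennreal_mult_less_top)
  finally have "(\<integral>\<^sup>+z. indicator \<Omega> z * ennreal (cmod (g (t - fst z))) \<partial>lborel)\<^sup>2 < \<infinity>" .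
  then have "(\<integral>\<^sup>+z. indicator \<Omega> z * ennreal (cmod (g (t - fst z))) \<partial>lborel) < \<infinity>"
    by (simp add: power_less_top_ennreal)
  then show "(\<integral>\<^sup>+z. ennreal (norm (indicat_real \<Omega> z *\<^sub>R (F z * tf_shift g z t))) \<partial>lborel) < \<infinity>"
    using nn_integral_synth_le[of t] by (simp add: ennreal_mult_less_top le_less_trans)
qed measurable

lemma synth_measurable: "synth g \<Omega> F \<in> borel_measurable borel"
  unfolding synth_def[abs_def] by measurable

text \<open>One factor |\<Omega>| comes from Cauchy-Schwarz in z at fixed t, the other from the
  subsequent integration over t.\<close>

lemma nn_integral_synth: "(\<integral>\<^sup>+t. ennreal ((cmod (synth g \<Omega> F t))\<^sup>2) \<partial>lborel) \<le> ennreal ((C * measure lborel \<Omega>)\<^sup>2)"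
proof -
  note [measurable] = synth_measurable
  have "ennreal ((cmod (synth g \<Omega> F t))\<^sup>2) \<le> ennreal (C\<^sup>2) * (emeasure lborel \<Omega> *
      (\<integral>\<^sup>+z. indicator \<Omega> z * ennreal ((cmod (g (t - fst z)))\<^sup>2) \<partial>lborel))" for t
  proof -
    have "ennreal (cmod (synth g \<Omega> F t)) \<le> ennreal C * (\<integral>\<^sup>+z. indicator \<Omega> z * ennreal (cmod (g (t - fst z))) \<partial>lborel)"
      unfolding synth_def using integral_norm_bound_ennreal[OF synth_integrable] nn_integral_synth_le
      by (rule order_trans)
    then have "(ennreal (cmod (synth g \<Omega> F t)))\<^sup>2 \<le> (ennreal C)\<^sup>2 * (\<integral>\<^sup>+z. indicator \<Omega> z * ennreal (cmod (g (t - fst z))) \<partial>lborel)\<^sup>2"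
      unfolding power_mult_distrib[symmetric] by (rule power_mono) simp
    also have "\<dots> \<le> (ennreal C)\<^sup>2 * (emeasure lborel \<Omega> * (\<integral>\<^sup>+z. indicator \<Omega> z * ennreal ((cmod (g (t - fst z)))\<^sup>2) \<partial>lborel))"
      by (intro mult_left_mono window_slice_square) simp
    finally show ?thesis using C(2) by (simp add: ennreal_power)
  qed
  then have "(\<integral>\<^sup>+t. ennreal ((cmod (synth g \<Omega> F t))\<^sup>2) \<partial>lborel) \<le> (\<integral>\<^sup>+t. ennreal (C\<^sup>2) * (emeasure lborel \<Omega> *
      (\<integral>\<^sup>+z. indicator \<Omega> z * ennreal ((cmod (g (t - fst z)))\<^sup>2) \<partial>lborel)) \<partial>lborel)"
    by (intro nn_integral_mono) simp
  also have "\<dots> = ennreal (C\<^sup>2) * (emeasure lborel \<Omega> * emeasure lborel \<Omega>)"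
    by (simp add: nn_integral_cmult nn_integral_window)
  also have "\<dots> = ennreal ((C * measure lborel \<Omega>)\<^sup>2)"
    unfolding \<Omega>_emeasure using C(2) by (simp add: power_mult_distrib power2_eq_square flip: ennreal_mult)
  finally show ?thesis .
qed

lemma synth_L2: "synth g \<Omega> F \<in> L2"
  using nn_integral_synth synth_measurable
  by (intro L2I) (auto simp: integrable_iff_bounded intro: le_less_trans)

text \<open>This turns uniform convergence of transforms on \<Omega> into L2 convergence of the
  synthesized functions.\<close>

lemma L2_norm_synth_le: "L2_norm (synth g \<Omega> F) \<le> C * measure lborel \<Omega>"
proof (rule power2_le_imp_le)
  show "(L2_norm (synth g \<Omega> F))\<^sup>2 \<le> (C * measure lborel \<Omega>)\<^sup>2"
    using nn_integral_synth by (simp add: nn_integral_L2_norm[OF synth_L2])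
qed (use C in simp)

text \<open>Adjointness of synthesis and transform. The kernel is absolutely integrable because
  \<open>F\<close> is bounded on \<Omega> and \<Omega> has finite measure.\<close>

lemma synth_inner:
  assumes k: "k \<in> L2"
  shows "L2_inner (synth g \<Omega> F) k = (LINT z|lborel. indicat_real \<Omega> z *\<^sub>R (F z * cnj (stft g k z)))"
proof -
  note [measurable] = L2_measurable[OF k]
  define K where "K = (\<lambda>(z, t). indicat_real \<Omega> z *\<^sub>R (F z * tf_shift g z t) * cnj (k t))"
  have K: "integrable lborel K"
  proof (rule integrable_lborel_pairI[where k="\<lambda>z. indicat_real \<Omega> z * (C * L2_norm k)"])
    show "K \<in> borel_measurable borel"
      unfolding K_def case_prod_unfold by measurable
    show "integrable lborel (\<lambda>t. K (z, t))" for z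
      using L2_inner_integrable[OF tf_shift_L2[OF g, of z] k] by (simp add: K_def mult.assoc)
    show "(LINT t|lborel. norm (K (z, t))) \<le> indicat_real \<Omega> z * (C * L2_norm k)" for z
    proof -
      have "(LINT t|lborel. norm (K (z, t))) =
          indicat_real \<Omega> z * cmod (F z) * (LINT t|lborel. cmod (tf_shift g z t) * cmod (k t))"
        by (simp add: K_def norm_mult mult.assoc)
      also have "\<dots> \<le> indicat_real \<Omega> z * cmod (F z) * (L2_norm (tf_shift g z) * L2_norm k)"
        by (intro mult_left_mono L2_Cauchy_Schwarz_abs tf_shift_L2 g k) simp
      also have "\<dots> \<le> indicat_real \<Omega> z * (C * L2_norm k)"
        using C by (cases "z \<in> \<Omega>") (simp_all add: L2_norm_tf_shift g g_norm L2_norm_nonneg mult_right_mono)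
      finally show ?thesis .
    qed
    show "integrable lborel (\<lambda>z. indicat_real \<Omega> z * (C * L2_norm k))"
      using \<Omega>_finite by simp
  qed
  have "L2_inner (synth g \<Omega> F) k = (LINT t|lborel. LINT z|lborel. K (z, t))"
    unfolding L2_inner_def synth_def K_def prod.case integral_mult_left_zero ..
  also have "\<dots> = (LINT z|lborel. LINT t|lborel. K (z, t))"
    using integral_lborel_pair_fst[OF K] integral_lborel_pair_snd[OF K] by simp
  also have "\<dots> = (LINT z|lborel. indicat_real \<Omega> z *\<^sub>R (F z * L2_inner (tf_shift g z) k))"
    by (simp add: K_def L2_inner_def mult.assoc)
  finally show ?thesis
    by (simp add: stft_eq_inner L2_inner_commute[symmetric])
qed

end

section \<open>The localization operator and its quadratic form\<close>

lemma stft_bound: "f \<in> L2 \<Longrightarrow> cmod (stft g f z) \<le> L2_norm f"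
  using cmod_stft_le[of f g z] g g_norm by simp

lemma stft_borel: "f \<in> L2 \<Longrightarrow> stft g f \<in> borel_measurable borel"
  using stft_L2(1)[OF _ g] by (blast intro: L2_measurable)

lemma loc_op_L2: "f \<in> L2 \<Longrightarrow> loc_op g \<Omega> f \<in> L2"
  unfolding loc_op_eq_synth by (intro synth_L2[of _ "L2_norm f"] stft_bound stft_borel L2_norm_nonneg)

text \<open>The map T with H = T* T, see \<open>loc_op_inner\<close>. Symmetry, positivity and the
  Cauchy-Schwarz inequality for the form of H come from the inner product on phase space.\<close>

definition cut_stft :: "('a \<Rightarrow> complex) \<Rightarrow> 'a \<times> 'a \<Rightarrow> complex" where
  "cut_stft f z = indicator \<Omega> z * stft g f z"

lemma cut_stft_L2: "f \<in> L2 \<Longrightarrow> cut_stft f \<in> L2"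
  unfolding cut_stft_def[abs_def] using stft_borel[of f] L2_integrable[OF stft_L2(1)[of f g]] g
  by (intro L2_dominated[where k="\<lambda>z. (cmod (stft g f z))\<^sup>2"]) (auto simp: indicator_def)

text \<open>The quadratic form <H f, f>, see \<open>loc_op_energy\<close>.\<close>

definition energy :: "('a \<Rightarrow> complex) \<Rightarrow> real" where
  "energy f = (L2_norm (cut_stft f))\<^sup>2"

lemma loc_op_inner:
  assumes "f \<in> L2" "k \<in> L2"
  shows "L2_inner (loc_op g \<Omega> f) k = L2_inner (cut_stft f) (cut_stft k)"
proof -
  have "L2_inner (loc_op g \<Omega> f) k = (LINT z|lborel. indicat_real \<Omega> z *\<^sub>R (stft g f z * cnj (stft g k z)))"
    unfolding loc_op_eq_synth using assms
    by (intro synth_inner[of _ "L2_norm f"] stft_bound stft_borel L2_norm_nonneg)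
  also have "\<dots> = L2_inner (cut_stft f) (cut_stft k)"
    unfolding L2_inner_def cut_stft_def by (intro Bochner_Integration.integral_cong) (auto simp: indicator_def)
  finally show ?thesis .
qed

lemma loc_op_symmetric:
  "f \<in> L2 \<Longrightarrow> k \<in> L2 \<Longrightarrow> L2_inner (loc_op g \<Omega> f) k = L2_inner f (loc_op g \<Omega> k)"
  by (metis loc_op_inner L2_inner_commute)

lemma loc_op_energy: "f \<in> L2 \<Longrightarrow> L2_inner (loc_op g \<Omega> f) f = of_real (energy f)"
  by (simp add: loc_op_inner L2_inner_self energy_def)

lemma energy_nonneg: "0 \<le> energy f"
  by (simp add: energy_def)

lemma energy_eq: "energy f = (LINT z|lborel. indicat_real \<Omega> z * (cmod (stft g f z))\<^sup>2)"
  unfolding energy_def L2_norm_square cut_stft_def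
  by (intro Bochner_Integration.integral_cong) (auto simp: indicator_def)

lemma energy_le: "f \<in> L2 \<Longrightarrow> energy f \<le> (L2_norm f)\<^sup>2"
proof -
  assume f: "f \<in> L2"
  have "energy f \<le> (LINT z|lborel. (cmod (stft g f z))\<^sup>2)"
    unfolding energy_def L2_norm_square using L2_integrable[OF cut_stft_L2[OF f]] L2_integrable[OF stft_L2(1)[OF f g]]
    by (intro integral_mono) (auto simp: cut_stft_def indicator_def)
  also have "\<dots> = (L2_norm f)\<^sup>2"
    using stft_L2(2)[OF f g] g_norm by (simp flip: L2_norm_square)
  finally show ?thesis .
qed

lemma energy_scale: "energy (\<lambda>t. c * f t) = (cmod c)\<^sup>2 * energy f"
proof -
  have "cut_stft (\<lambda>t. c * f t) = (\<lambda>z. c * cut_stft f z)"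
    by (simp add: fun_eq_iff cut_stft_def stft_scale)
  then show ?thesis by (simp add: energy_def L2_norm_scale power_mult_distrib)
qed

text \<open>Serves to show that near-maximisers of the energy are approximate eigenvectors: by
  symmetry both mixed terms are energies.\<close>

lemma norm_loc_op_diff:
  assumes f: "f \<in> L2"
  shows "(L2_norm (\<lambda>t. loc_op g \<Omega> f t - of_real m * f t))\<^sup>2 =
    (L2_norm (loc_op g \<Omega> f))\<^sup>2 - 2 * m * energy f + m\<^sup>2 * (L2_norm f)\<^sup>2"
proof -
  let ?H = "loc_op g \<Omega> f" and ?mf = "\<lambda>t. of_real m * f t"
  have H: "?H \<in> L2" "?mf \<in> L2" "(\<lambda>t. ?H t - ?mf t) \<in> L2"
    using f by (auto intro: loc_op_L2 L2_scale L2_diff)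
  have "of_real ((L2_norm (\<lambda>t. ?H t - ?mf t))\<^sup>2) = L2_inner (\<lambda>t. ?H t - ?mf t) (\<lambda>t. ?H t - ?mf t)"
    by (rule L2_inner_self[symmetric])
  also have "\<dots> = L2_inner ?H ?H - of_real m * L2_inner ?H f - of_real m * L2_inner f ?H
      + of_real m * (of_real m * L2_inner f f)"
    using H f by (simp add: L2_inner_diff_left L2_inner_diff_right L2_inner_scale_left L2_inner_scale_right algebra_simps)
  also have "L2_inner f ?H = of_real (energy f)"
    using loc_op_symmetric[OF f f] loc_op_energy[OF f] by simp
  also have "L2_inner ?H f = of_real (energy f)"
    by (rule loc_op_energy[OF f])
  also have "L2_inner ?H ?H - of_real m * of_real (energy f) - of_real m * of_real (energy f)
        + of_real m * (of_real m * L2_inner f f) =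
      of_real ((L2_norm ?H)\<^sup>2 - 2 * m * energy f + m\<^sup>2 * (L2_norm f)\<^sup>2)"
    by (simp add: L2_inner_self power2_eq_square)
  finally show ?thesis by (simp only: of_real_eq_iff)
qed

section \<open>Eigenfunctions as maximisers of the energy on an orthogonal complement\<close>

definition perp :: "nat set \<Rightarrow> (nat \<Rightarrow> 'a \<Rightarrow> complex) \<Rightarrow> ('a \<Rightarrow> complex) set" where
  "perp J h = {f \<in> L2. \<forall>k\<in>J. L2_inner f (h k) = 0}"

text \<open>Compactness of the operator enters through Arzela-Ascoli: the transforms of a bounded sequence
  are uniformly bounded and equicontinuous on \<open>\<Omega>\<close>. The eigenfunction is synthesized from the uniform
  limit, so completeness of \<open>L\<^sup>2\<close> is not needed.\<close>

lemma perp_eigenfunction: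
  assumes h: "\<And>k. k \<in> J \<Longrightarrow> h k \<in> L2"
    and eig: "\<And>k. k \<in> J \<Longrightarrow> AE t in lborel. loc_op g \<Omega> (h k) t = of_real (lam k) * h k t"
  obtains m where "m \<ge> 0" "\<And>f. f \<in> perp J h \<Longrightarrow> energy f \<le> m * (L2_norm f)\<^sup>2"
    "m = 0 \<or> (\<exists>y\<in>perp J h. (\<forall>t. loc_op g \<Omega> y t = of_real m * y t) \<and> L2_norm y \<noteq> 0)"
proof -
  \<comment> \<open>Admitting norms below 1 keeps 0 in \<open>S\<close>, so the supremum exists and
    is nonnegative even if the complement contains no function of positive norm.\<close>
  define S where "S = {energy f | f. f \<in> perp J h \<and> L2_norm f \<le> 1}"
  define m where "m = Sup S"
  have S_le: "s \<le> 1" if "s \<in> S" for s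
  proof -
    from that obtain f where f: "s = energy f" "f \<in> L2" "L2_norm f \<le> 1"
      by (auto simp: S_def perp_def)
    have "(L2_norm f)\<^sup>2 \<le> 1" using f(3) L2_norm_nonneg[of f] by (simp add: power_le_one)
    with energy_le[OF f(2)] f(1) show ?thesis by simp
  qed
  then have bdd: "bdd_above S" by (rule bdd_aboveI)
  have "(\<lambda>_. 0) \<in> perp J h" by (simp add: perp_def L2_zero L2_inner_def)
  moreover have "L2_norm (\<lambda>_. 0) \<le> 1" "energy (\<lambda>_. 0) = 0"
    using energy_scale[of 0 "\<lambda>_. 0"] by (simp_all add: L2_norm_def)
  ultimately have S0: "0 \<in> S" unfolding S_def by force
  have m0: "0 \<le> m" unfolding m_def by (rule cSup_upper[OF S0 bdd])
  have scale_perp: "(\<lambda>t. c * f t) \<in> perp J h" if "f \<in> perp J h" for c f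
    using that by (simp add: perp_def L2_scale L2_inner_scale_left)
  have m_bound: "energy f \<le> m * (L2_norm f)\<^sup>2" if f: "f \<in> perp J h" for f
  proof (cases "L2_norm f = 0")
    case True
    with f energy_le[of f] show ?thesis by (simp add: perp_def)
  next
    case False
    let ?c = "inverse (L2_norm f)"
    have "L2_norm (\<lambda>t. of_real ?c * f t) = 1"
      using False L2_norm_nonneg[of f] unfolding L2_norm_scale norm_of_real by simp
    then have "energy (\<lambda>t. of_real ?c * f t) \<in> S"
      unfolding S_def using scale_perp[OF f, of "of_real ?c"]
      by (intro CollectI exI[of _ "\<lambda>t. of_real ?c * f t"]) simp
    then have "energy (\<lambda>t. of_real ?c * f t) \<le> m"
      unfolding m_def using bdd by (rule cSup_upper)
    then have "?c\<^sup>2 * energy f \<le> m" unfolding energy_scale norm_of_real power2_abs .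
    then show ?thesis using False by (simp add: field_simps)
  qed
  \<comment> \<open>Symmetry moves the operator onto the eigenfunction, so the complement is
    invariant. This allows \<open>m_bound\<close> to be applied to H f itself.\<close>
  have H_perp: "loc_op g \<Omega> f \<in> perp J h" if f: "f \<in> perp J h" for f
    unfolding perp_def
  proof (intro CollectI conjI ballI)
    have fL: "f \<in> L2" using f by (simp add: perp_def)
    show "loc_op g \<Omega> f \<in> L2" using fL by (rule loc_op_L2)
    fix k assume k: "k \<in> J"
    have "L2_inner (loc_op g \<Omega> f) (h k) = L2_inner f (loc_op g \<Omega> (h k))"
      using loc_op_symmetric[OF fL h[OF k]] .
    also have "\<dots> = cnj (L2_inner (loc_op g \<Omega> (h k)) f)"
      by (rule L2_inner_commute)
    also have "L2_inner (loc_op g \<Omega> (h k)) f = L2_inner (\<lambda>t. of_real (lam k) * h k t) f"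
      using h[OF k] fL eig[OF k] by (intro L2_inner_cong_AE loc_op_L2 L2_scale)
    also have "\<dots> = of_real (lam k) * cnj (L2_inner f (h k))"
      by (simp add: L2_inner_scale_left L2_inner_commute[of "h k"])
    also have "\<dots> = 0" using f k by (simp add: perp_def)
    finally show "L2_inner (loc_op g \<Omega> f) (h k) = 0" by simp
  qed
  \<comment> \<open>Cauchy-Schwarz for the energy form, with H f as second argument, gives ||H f||^4
    <= energy f * energy (H f), and the last factor is at most m ||H f||^2.\<close>
  have H_bound: "(L2_norm (loc_op g \<Omega> f))\<^sup>2 \<le> m * energy f" if f: "f \<in> perp J h" for f
  proof (cases "L2_norm (loc_op g \<Omega> f) = 0")
    case True
    with m0 show ?thesis by (simp add: energy_nonneg)
  next
    case False
    let ?H = "loc_op g \<Omega> f"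
    have fL: "f \<in> L2" "?H \<in> L2" using f by (auto simp: perp_def loc_op_L2)
    have "cmod (of_real ((L2_norm ?H)\<^sup>2)) = cmod (L2_inner (cut_stft f) (cut_stft ?H))"
      unfolding L2_inner_self[symmetric] loc_op_inner[OF fL] ..
    also have "\<dots> \<le> L2_norm (cut_stft f) * L2_norm (cut_stft ?H)"
      by (intro L2_Cauchy_Schwarz cut_stft_L2 fL)
    finally have "((L2_norm ?H)\<^sup>2)\<^sup>2 \<le> (L2_norm (cut_stft f) * L2_norm (cut_stft ?H))\<^sup>2"
      by (intro power_mono) (simp_all add: norm_power L2_norm_nonneg)
    also have "\<dots> = energy f * energy ?H"
      by (simp add: energy_def power_mult_distrib)
    also have "\<dots> \<le> energy f * (m * (L2_norm ?H)\<^sup>2)"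
      by (intro mult_left_mono m_bound H_perp f energy_nonneg)
    finally have "(L2_norm ?H)\<^sup>2 * (L2_norm ?H)\<^sup>2 \<le> (m * energy f) * (L2_norm ?H)\<^sup>2"
      by (simp add: power2_eq_square mult_ac)
    then show ?thesis by (rule mult_right_le_imp_le) (use False in simp)
  qed
  have "\<exists>y\<in>perp J h. (\<forall>t. loc_op g \<Omega> y t = of_real m * y t) \<and> L2_norm y \<noteq> 0" if m: "m > 0"
  proof -
    have "\<exists>f. f \<in> perp J h \<and> L2_norm f \<le> 1 \<and> m - 1 / real (Suc n) < energy f" for n
    proof -
      have "m - 1 / real (Suc n) < Sup S" by (simp add: m_def)
      then obtain s where "s \<in> S" "m - 1 / real (Suc n) < s"
        using less_cSup_iff[OF _ bdd] S0 by blast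
      then show ?thesis by (auto simp: S_def)
    qed
    then obtain f where f: "\<And>n. f n \<in> perp J h" "\<And>n. L2_norm (f n) \<le> 1" "\<And>n. m - 1 / real (Suc n) < energy (f n)"
      by metis
    have fL: "f n \<in> L2" for n using f(1)[of n] by (simp add: perp_def)
    have sup: "energy (f n) \<le> m" for n
      unfolding m_def by (rule cSup_upper[OF _ bdd]) (use f in \<open>auto simp: S_def\<close>)
    have energy_lim: "(\<lambda>n. energy (f n)) \<longlonglongrightarrow> m"
    proof (rule tendsto_sandwich[OF _ _ _ tendsto_const])
      have "(\<lambda>n. m - inverse (real (Suc n))) \<longlonglongrightarrow> m - 0"
        by (intro tendsto_diff tendsto_const LIMSEQ_inverse_real_of_nat)
      then show "(\<lambda>n. m - 1 / real (Suc n)) \<longlonglongrightarrow> m" by (simp add: inverse_eq_divide)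
    qed (use f(3) sup in \<open>auto intro!: always_eventually less_imp_le\<close>)
    obtain G r where G: "continuous_on \<Omega> G" "strict_mono (r :: nat \<Rightarrow> nat)"
      "\<And>e. 0 < e \<Longrightarrow> \<exists>N. \<forall>n z. n \<ge> N \<and> z \<in> \<Omega> \<longrightarrow> norm (stft g (f (r n)) z - G z) < e"
    proof (rule Arzela_Ascoli[OF compact_\<Omega>, of "\<lambda>n. stft g (f n)" 1])
      show "norm (stft g (f n) z) \<le> 1" for n z
        using stft_bound[OF fL[of n], of z] f(2)[of n] by simp
      show "\<exists>d. 0 < d \<and> (\<forall>n w. w \<in> \<Omega> \<and> norm (z - w) < d \<longrightarrow> norm (stft g (f n) z - stft g (f n) w) < e)"
        if e: "0 < e" for z e
      proof -
        obtain d where d: "d > 0" "\<And>w. norm (z - w) < d \<Longrightarrow> L2_norm (\<lambda>t. tf_shift g z t - tf_shift g w t) < e"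
          using tf_shift_continuous[OF g e, of z] by blast
        have "norm (stft g (f n) z - stft g (f n) w) < e" if "norm (z - w) < d" for n w
        proof -
          have "norm (stft g (f n) z - stft g (f n) w) \<le> L2_norm (f n) * L2_norm (\<lambda>t. tf_shift g z t - tf_shift g w t)"
            by (rule cmod_stft_diff_le[OF fL g])
          also have "\<dots> \<le> 1 * L2_norm (\<lambda>t. tf_shift g z t - tf_shift g w t)"
            by (intro mult_right_mono f L2_norm_nonneg)
          finally show ?thesis using d(2)[OF that] by simp
        qed
        with d(1) show ?thesis by blast
      qed
    qed blast+
    \<comment> \<open>\<open>G\<close> is controlled on \<Omega> only; cutting it off there gives a
      Borel function on phase space and leaves the synthesis unchanged.\<close>
    define F where "F z = indicat_real \<Omega> z *\<^sub>R G z" for z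
    define y where "y = synth g \<Omega> F"
    have F_meas: "F \<in> borel_measurable borel"
      unfolding F_def[abs_def] using G(1) by (intro borel_measurable_continuous_on_indicator) simp_all
    obtain B where B: "\<And>z. z \<in> \<Omega> \<Longrightarrow> cmod (F z) \<le> B" "0 \<le> B"
    proof -
      have "bounded (G ` \<Omega>)"
        by (intro compact_imp_bounded compact_continuous_image G compact_\<Omega>)
      then obtain B where "\<And>z. z \<in> \<Omega> \<Longrightarrow> cmod (G z) \<le> B" "0 < B"
        unfolding bounded_pos by auto
      then show ?thesis by (intro that[of B]) (auto simp: F_def)
    qed
    have yL: "y \<in> L2" unfolding y_def by (rule synth_L2[OF F_meas B])
    have H_close: "L2_norm (\<lambda>t. loc_op g \<Omega> (f (r n)) t - y t) \<le> e * measure lborel \<Omega>"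
      if e: "0 < e" "\<And>z. z \<in> \<Omega> \<Longrightarrow> norm (stft g (f (r n)) z - G z) < e" for n e
    proof -
      have "loc_op g \<Omega> (f (r n)) t - y t = synth g \<Omega> (\<lambda>z. stft g (f (r n)) z - F z) t" for t
        unfolding loc_op_eq_synth y_def synth_def
        using synth_integrable[OF stft_borel[OF fL] stft_bound[OF fL] L2_norm_nonneg, of "r n" t] synth_integrable[OF F_meas B, of t]
        by (subst Bochner_Integration.integral_diff[symmetric]) (simp_all add: algebra_simps)
      moreover have "L2_norm (synth g \<Omega> (\<lambda>z. stft g (f (r n)) z - F z)) \<le> e * measure lborel \<Omega>"
      proof (rule L2_norm_synth_le)
        show "(\<lambda>z. stft g (f (r n)) z - F z) \<in> borel_measurable borel"
          using stft_borel[OF fL[of "r n"]] F_meas by measurable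
        show "cmod (stft g (f (r n)) z - F z) \<le> e" if "z \<in> \<Omega>" for z
          using e(2)[OF that] that by (simp add: F_def)
      qed (use e in simp)
      ultimately show ?thesis by simp
    qed
    have H_lim: "(\<lambda>n. L2_norm (\<lambda>t. loc_op g \<Omega> (f (r n)) t - y t)) \<longlonglongrightarrow> 0"
    proof (rule LIMSEQ_I)
      fix e :: real assume e: "e > 0"
      \<comment> \<open>The added 1 covers the case of a null set \<Omega>.\<close>
      define e' where "e' = e / (measure lborel \<Omega> + 1)"
      have e': "e' > 0" using e by (simp add: e'_def add_nonneg_pos)
      have "e' * measure lborel \<Omega> < e' * (measure lborel \<Omega> + 1)" using e' by simp
      also have "\<dots> = e" by (simp add: e'_def add_nonneg_eq_0_iff)
      finally have le: "e' * measure lborel \<Omega> < e" .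
      obtain N where "\<And>n z. n \<ge> N \<Longrightarrow> z \<in> \<Omega> \<Longrightarrow> norm (stft g (f (r n)) z - G z) < e'"
        using G(3)[OF e'] by blast
      then have "L2_norm (\<lambda>t. loc_op g \<Omega> (f (r n)) t - y t) \<le> e' * measure lborel \<Omega>" if "n \<ge> N" for n
        using that by (intro H_close e') auto
      with le show "\<exists>N. \<forall>n\<ge>N. norm (L2_norm (\<lambda>t. loc_op g \<Omega> (f (r n)) t - y t) - 0) < e"
        by (intro exI[of _ N]) (auto simp: L2_norm_nonneg intro: le_less_trans)
    qed
    define \<delta> where "\<delta> n = L2_norm (\<lambda>t. of_real m * f (r n) t - y t)" for n
    have \<delta>: "\<delta> \<longlonglongrightarrow> 0"
    proof -
      \<comment> \<open>With E the energy of f, expanding the square and inserting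
        \<open>H_bound\<close> gives ||H f - m f||^2 <= m E - 2 m E + m^2 = m (m - E). The triangle
        inequality through H f accounts for the factors 2.\<close>
      have le: "(\<delta> n)\<^sup>2 \<le> 2 * (m * (m - energy (f (r n)))) + 2 * (L2_norm (\<lambda>t. loc_op g \<Omega> (f (r n)) t - y t))\<^sup>2" for n
      proof -
        let ?H = "loc_op g \<Omega> (f (r n))"
        have "(\<delta> n)\<^sup>2 = (L2_norm (\<lambda>t. (-1) * (?H t - of_real m * f (r n) t) + (?H t - y t)))\<^sup>2"
          by (simp add: \<delta>_def)
        also have "\<dots> \<le> 2 * (L2_norm (\<lambda>t. (-1) * (?H t - of_real m * f (r n) t)))\<^sup>2 + 2 * (L2_norm (\<lambda>t. ?H t - y t))\<^sup>2"
          by (intro L2_norm_add_square_le L2_scale L2_diff loc_op_L2 fL yL)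
        also have "(L2_norm (\<lambda>t. (-1) * (?H t - of_real m * f (r n) t)))\<^sup>2 =
            (L2_norm ?H)\<^sup>2 - 2 * m * energy (f (r n)) + m\<^sup>2 * (L2_norm (f (r n)))\<^sup>2"
          unfolding L2_norm_scale using norm_loc_op_diff[OF fL] by simp
        also have "\<dots> \<le> m * energy (f (r n)) - 2 * m * energy (f (r n)) + m\<^sup>2 * 1"
          using f(2)[of "r n"] L2_norm_nonneg[of "f (r n)"] m
          by (intro add_mono diff_mono H_bound f mult_left_mono) (auto simp: power_le_one)
        finally show ?thesis by (simp add: power2_eq_square algebra_simps)
      qed
      have "(\<lambda>n. 2 * (m * (m - energy (f (r n)))) + 2 * (L2_norm (\<lambda>t. loc_op g \<Omega> (f (r n)) t - y t))\<^sup>2)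
          \<longlonglongrightarrow> 2 * (m * (m - m)) + 2 * 0\<^sup>2"
        using LIMSEQ_subseq_LIMSEQ[OF energy_lim G(2)] by (intro tendsto_intros H_lim) (simp add: o_def)
      then have lim: "(\<lambda>n. 2 * (m * (m - energy (f (r n)))) + 2 * (L2_norm (\<lambda>t. loc_op g \<Omega> (f (r n)) t - y t))\<^sup>2) \<longlonglongrightarrow> 0"
        by simp
      have "(\<lambda>n. (\<delta> n)\<^sup>2) \<longlonglongrightarrow> 0"
        by (rule tendsto_sandwich[OF _ _ tendsto_const lim]) (use le in simp_all)
      then show ?thesis by simp
    qed
    have mf: "(\<lambda>t. of_real m * f (r n) t) \<in> L2" for n by (intro L2_scale fL)
    \<comment> \<open>Point evaluation of the transform is bounded on L2, so L2 convergence of m f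
      to \<open>y\<close> and uniform convergence to \<open>G\<close> must agree on \<Omega>. As the
      operator sees the transform only on \<Omega>, the eigenvalue equation for \<open>y\<close>
      follows at every t.\<close>
    have stft_y: "stft g y z = of_real m * F z" if z: "z \<in> \<Omega>" for z
    proof -
      have "cmod (of_real m * stft g (f (r n)) z - stft g y z) \<le> \<delta> n" for n
        using stft_bound[OF L2_diff[OF mf yL], of n z] stft_diff[OF mf yL g, of n z]
        by (simp add: \<delta>_def stft_scale)
      then have "(\<lambda>n. of_real m * stft g (f (r n)) z - stft g y z) \<longlonglongrightarrow> 0"
        by (intro Lim_null_comparison[OF _ \<delta>]) simp
      then have "(\<lambda>n. of_real m * stft g (f (r n)) z) \<longlonglongrightarrow> stft g y z"
        by (simp add: LIM_zero_iff)
      moreover have "(\<lambda>n. stft g (f (r n)) z) \<longlonglongrightarrow> G z"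
        using G(3) z by (intro LIMSEQ_I) blast
      then have "(\<lambda>n. of_real m * stft g (f (r n)) z) \<longlonglongrightarrow> of_real m * G z"
        by (intro tendsto_intros)
      ultimately show ?thesis
        using z by (simp add: F_def LIMSEQ_unique)
    qed
    have "loc_op g \<Omega> y t = of_real m * y t" for t
      unfolding loc_op_eq_synth y_def synth_scale[symmetric]
      using synth_cong[of \<Omega> "stft g y" "\<lambda>z. of_real m * F z" g] stft_y by (simp add: y_def)
    moreover have "y \<in> perp J h"
      unfolding perp_def
    proof (intro CollectI conjI ballI yL)
      fix k assume k: "k \<in> J"
      have "cmod (L2_inner y (h k)) \<le> \<delta> n * L2_norm (h k)" for n
        using L2_Cauchy_Schwarz[OF L2_diff[OF mf yL] h[OF k], of n] f(1)[of "r n"] k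
          L2_inner_diff_left[OF mf yL h[OF k], of n]
        by (simp add: \<delta>_def L2_inner_scale_left perp_def)
      moreover have "(\<lambda>n. \<delta> n * L2_norm (h k)) \<longlonglongrightarrow> 0 * L2_norm (h k)"
        by (intro tendsto_intros \<delta>)
      ultimately have "cmod (L2_inner y (h k)) \<le> 0"
        by (intro tendsto_lowerbound[of "\<lambda>n. \<delta> n * L2_norm (h k)" 0 sequentially]) simp_all
      then show "L2_inner y (h k) = 0" by simp
    qed
    \<comment> \<open>Otherwise m f would tend to 0 in L2, hence so would m^2 times the energies;
      but the energies tend to m, which forces m^3 <= 0.\<close>
    moreover have "L2_norm y \<noteq> 0"
    proof
      assume y0: "L2_norm y = 0"
      have le: "m\<^sup>2 * energy (f (r n)) \<le> 2 * (\<delta> n)\<^sup>2" for n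
      proof -
        have "m\<^sup>2 * energy (f (r n)) \<le> (L2_norm (\<lambda>t. of_real m * f (r n) t))\<^sup>2"
          using energy_le[OF fL] by (simp add: L2_norm_scale power_mult_distrib mult_left_mono)
        also have "\<dots> = (L2_norm (\<lambda>t. (of_real m * f (r n) t - y t) + y t))\<^sup>2" by simp
        also have "\<dots> \<le> 2 * (\<delta> n)\<^sup>2 + 2 * (L2_norm y)\<^sup>2"
          unfolding \<delta>_def by (intro L2_norm_add_square_le L2_diff mf yL)
        finally show ?thesis by (simp add: y0)
      qed
      have lim1: "(\<lambda>n. m\<^sup>2 * energy (f (r n))) \<longlonglongrightarrow> m\<^sup>2 * m"
        using LIMSEQ_subseq_LIMSEQ[OF energy_lim G(2)] by (intro tendsto_intros) (simp add: o_def)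
      have lim2: "(\<lambda>n. 2 * (\<delta> n)\<^sup>2) \<longlonglongrightarrow> 2 * 0\<^sup>2"
        by (intro tendsto_intros \<delta>)
      have "m\<^sup>2 * m \<le> 2 * 0\<^sup>2"
        by (rule LIMSEQ_le[OF lim1 lim2]) (use le in blast)
      with m show False by (simp add: mult_le_0_iff)
    qed
    ultimately show ?thesis by blast
  qed
  with m0 show ?thesis
    by (intro that[of m] m_bound) (auto simp: le_less)
qed

end

section \<open>Eigenfunction expansions\<close>

text \<open>The parameter \<open>s\<close> allows two uses with the same coefficient
  \<open>c\<close>: for a function and an eigenfunction (s = 1), and for their cut transforms in
  phase space (s the eigenvalue).\<close>

lemma L2_norm_diff_scale:
  assumes a: "a \<in> L2" and b: "b \<in> L2" and s: "L2_inner a b = of_real s * c"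
  shows "(L2_norm (\<lambda>t. a t - c * b t))\<^sup>2 = (L2_norm a)\<^sup>2 - 2 * s * (cmod c)\<^sup>2 + (cmod c)\<^sup>2 * (L2_norm b)\<^sup>2"
proof -
  have cb: "(\<lambda>t. c * b t) \<in> L2" by (rule L2_scale[OF b])
  have s': "L2_inner b a = of_real s * cnj c"
    using s L2_inner_commute[of b a] by simp
  have "of_real ((L2_norm (\<lambda>t. a t - c * b t))\<^sup>2) = L2_inner (\<lambda>t. a t - c * b t) (\<lambda>t. a t - c * b t)"
    by (rule L2_inner_self[symmetric])
  also have "\<dots> = L2_inner a a - cnj c * L2_inner a b - (c * L2_inner b a - c * (cnj c * L2_inner b b))"
    using a b cb by (simp add: L2_inner_diff_left L2_inner_diff_right L2_diff L2_inner_scale_left L2_inner_scale_right algebra_simps)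
  also have "\<dots> = of_real ((L2_norm a)\<^sup>2) - 2 * of_real s * (c * cnj c) + (c * cnj c) * of_real ((L2_norm b)\<^sup>2)"
    unfolding s s' L2_inner_self by (simp add: algebra_simps)
  also have "\<dots> = of_real ((L2_norm a)\<^sup>2 - 2 * s * (cmod c)\<^sup>2 + (cmod c)\<^sup>2 * (L2_norm b)\<^sup>2)"
    unfolding complex_norm_square[symmetric] by simp
  finally show ?thesis by (simp only: of_real_eq_iff)
qed

text \<open>Covariance of the transform: substituting t + x for t pulls out a phase factor of
  modulus 1.\<close>

lemma cmod_stft_tf_shift:
  assumes [measurable]: "g \<in> borel_measurable borel"
  shows "cmod (stft g (tf_shift g z) w) = cmod (stft g g (w - z))"
proof -
  let ?x = "fst z" and ?y = "fst w" and ?s = "snd w - snd z"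
  have "stft g (tf_shift g z) w = (LINT t|lborel. g (t - ?x) * cnj (g (t - ?y)) * ft_char (?s \<bullet> t))"
    unfolding stft_eq tf_shift_eq inner_diff_left ft_char_diff by (simp only: mult_ac)
  also have "\<dots> = (LINT t|lborel. g (t + ?x - ?x) * cnj (g (t + ?x - ?y)) * ft_char (?s \<bullet> (t + ?x)))"
    by (rule integral_lborel_plus[symmetric]) measurable
  also have "\<dots> = (LINT t|lborel. ft_char (?s \<bullet> ?x) * (g t * cnj (g (t - fst (w - z))) * ft_char (snd (w - z) \<bullet> t)))"
  proof (rule Bochner_Integration.integral_cong[OF refl])
    fix t
    have "ft_char (?s \<bullet> (t + ?x)) = ft_char (?s \<bullet> ?x) * ft_char (?s \<bullet> t)"
      by (simp add: inner_add_right algebra_simps flip: exp_add)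
    moreover have "t + ?x - ?x = t" "t + ?x - ?y = t - fst (w - z)" "snd (w - z) = ?s" by simp_all
    ultimately show "g (t + ?x - ?x) * cnj (g (t + ?x - ?y)) * ft_char (?s \<bullet> (t + ?x)) =
        ft_char (?s \<bullet> ?x) * (g t * cnj (g (t - fst (w - z))) * ft_char (snd (w - z) \<bullet> t))"
      by (simp only: mult_ac)
  qed
  also have "\<dots> = ft_char (?s \<bullet> ?x) * stft g g (w - z)"
    unfolding stft_eq by (rule integral_mult_right_zero)
  finally show ?thesis
    by (simp only: norm_mult norm_ft_char mult_1_left)
qed

section \<open>The blurred indicator and the trace of the squared operator\<close>

context tf_window
begin

text \<open>By Moyal's identity a probability density on phase space.\<close>

definition ambig :: "'a \<times> 'a \<Rightarrow> real" where "ambig w = (cmod (stft g g w))\<^sup>2"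

text \<open>The function B; the argument \<open>w - z\<close> is the reflection in the
  convolution.\<close>

definition blur :: "'a \<times> 'a \<Rightarrow> real" where
  "blur z = (LINT w|lborel. indicat_real \<Omega> w * ambig (w - z))"

lemma ambig_measurable [measurable]: "ambig \<in> borel_measurable borel"
  unfolding ambig_def[abs_def] by measurable

lemma ambig_nonneg: "0 \<le> ambig w"
  by (simp add: ambig_def)

lemma ambig_integrable: "integrable lborel ambig"
  unfolding ambig_def[abs_def] by (rule L2_integrable[OF stft_L2(1)[OF g g]])

lemma ambig_integral: "(LINT w|lborel. ambig w) = 1"
  unfolding ambig_def L2_norm_square[symmetric] stft_L2(2)[OF g g] by (simp add: g_norm)

lemma energy_tf_shift: "energy (tf_shift g z) = blur z"
  by (simp add: energy_eq blur_def ambig_def cmod_stft_tf_shift)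

lemma blur_nonneg: "0 \<le> blur z"
  unfolding energy_tf_shift[symmetric] by (rule energy_nonneg)

lemma blur_le_1: "blur z \<le> 1"
  using energy_le[OF tf_shift_L2[OF g, of z]] by (simp add: energy_tf_shift L2_norm_tf_shift g g_norm)

lemma blur_measurable [measurable]: "blur \<in> borel_measurable borel"
  unfolding blur_def[abs_def] by measurable

lemma blur_slice_integrable: "integrable lborel (\<lambda>w. indicat_real \<Omega> w * ambig (w - z))"
proof (rule Bochner_Integration.integrable_bound)
  show "integrable lborel (\<lambda>w. ambig (w - z))"
    using ambig_integrable by (simp add: integrable_lborel_shift)
qed (auto simp: indicator_def ambig_nonneg)

lemma nn_integral_blur: "(\<integral>\<^sup>+z. ennreal (blur z) \<partial>lborel) = ennreal (measure lborel \<Omega>)"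
proof -
  have "(\<integral>\<^sup>+z. ennreal (blur z) \<partial>lborel) = (\<integral>\<^sup>+z. \<integral>\<^sup>+w. ennreal (indicat_real \<Omega> w * ambig (w - z)) \<partial>lborel \<partial>lborel)"
    unfolding blur_def
    by (intro nn_integral_cong nn_integral_eq_integral[symmetric] blur_slice_integrable) (simp add: ambig_nonneg)
  also have "\<dots> = (\<integral>\<^sup>+p. ennreal (indicat_real \<Omega> (snd p) * ambig (snd p - fst p)) \<partial>lborel)"
    by (subst nn_integral_lborel_pair_fst) simp_all
  also have "\<dots> = (\<integral>\<^sup>+w. \<integral>\<^sup>+z. ennreal (indicat_real \<Omega> w * ambig (w - z)) \<partial>lborel \<partial>lborel)"
    by (subst nn_integral_lborel_pair_snd) simp_all
  also have "\<dots> = (\<integral>\<^sup>+w. indicator \<Omega> w * (\<integral>\<^sup>+z. ennreal (ambig (w - z)) \<partial>lborel) \<partial>lborel)"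
    by (simp add: ennreal_mult ennreal_indicator ambig_nonneg nn_integral_cmult)
  also have "\<dots> = (\<integral>\<^sup>+w. indicator \<Omega> w * ennreal 1 \<partial>lborel)"
    using nn_integral_lborel_reflect[of "\<lambda>z. ennreal (ambig z)"] ambig_integral
    by (simp add: nn_integral_eq_integral ambig_integrable ambig_nonneg)
  finally show ?thesis by (simp add: \<Omega>_emeasure)
qed

lemma blur_integrable: "integrable lborel blur"
  using nn_integral_blur by (simp add: integrable_iff_bounded blur_nonneg)

lemma blur_integral: "(LINT z|lborel. blur z) = measure lborel \<Omega>"
  using nn_integral_blur nn_integral_eq_integral[OF blur_integrable] blur_nonneg
  by (simp add: Bochner_Integration.integral_nonneg)

text \<open>The trace of H^2, as \<open>mu_square_sums\<close> shows. Being defined through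
  \<open>g\<close> and \<Omega> alone, its asymptotics under dilation can be found without looking
  at eigenvalues.\<close>

definition trace2 :: real where
  "trace2 = (LINT z|lborel. indicat_real \<Omega> z * blur z)"

lemma blur_cut_integrable: "integrable lborel (\<lambda>z. indicat_real \<Omega> z * blur z)"
  by (rule Bochner_Integration.integrable_bound[OF blur_integrable]) (auto simp: indicator_def blur_nonneg)

text \<open>The covariogram |\<Omega> \<inter> (\<Omega> - u)|. Writing \<open>trace2\<close> as its
  integral against \<open>ambig\<close> isolates the effect of a dilation, which rescales the
  covariogram and leaves \<open>ambig\<close> fixed.\<close>

definition overlap :: "'a \<times> 'a \<Rightarrow> real" where
  "overlap u = (LINT z|lborel. indicat_real \<Omega> z * indicat_real \<Omega> (z + u))"

lemma trace2_overlap: "trace2 = (LINT u|lborel. ambig u * overlap u)"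
proof -
  define K where "K = (\<lambda>(z, u). ambig u * (indicat_real \<Omega> z * indicat_real \<Omega> (z + u)))"
  have K: "integrable lborel K"
  proof (rule integrable_lborel_pairI[where k="indicat_real \<Omega>"])
    show "K \<in> borel_measurable borel"
      unfolding K_def case_prod_unfold by measurable
    have le: "norm (K (z, u)) \<le> indicat_real \<Omega> z * ambig u" for z u
      by (auto simp: K_def indicator_def ambig_nonneg)
    show i: "integrable lborel (\<lambda>u. K (z, u))" for z
      unfolding K_def prod.case
      by (rule Bochner_Integration.integrable_bound[OF ambig_integrable]) (auto simp: indicator_def)
    show "(LINT u|lborel. norm (K (z, u))) \<le> indicat_real \<Omega> z" for z
    proof -
      have "(LINT u|lborel. norm (K (z, u))) \<le> (LINT u|lborel. indicat_real \<Omega> z * ambig u)"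
        using i ambig_integrable le by (intro integral_mono) auto
      then show ?thesis by (simp add: ambig_integral)
    qed
    show "integrable lborel (indicat_real \<Omega>)" using \<Omega>_finite by simp
  qed
  have "trace2 = (LINT z|lborel. LINT u|lborel. K (z, u))"
    unfolding trace2_def
  proof (rule Bochner_Integration.integral_cong[OF refl])
    fix z
    have "blur z = (LINT w|lborel. indicat_real \<Omega> (w + z) * ambig (w + z - z))"
      unfolding blur_def by (rule integral_lborel_plus[symmetric]) measurable
    then have "indicat_real \<Omega> z * blur z = (LINT u|lborel. indicat_real \<Omega> z * (indicat_real \<Omega> (u + z) * ambig u))"
      by simp
    also have "\<dots> = (LINT u|lborel. K (z, u))"
      by (rule Bochner_Integration.integral_cong) (simp_all add: K_def add.commute mult_ac)
    finally show "indicat_real \<Omega> z * blur z = (LINT u|lborel. K (z, u))" .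
  qed
  also have "\<dots> = (LINT u|lborel. LINT z|lborel. K (z, u))"
    using integral_lborel_pair_fst[OF K] integral_lborel_pair_snd[OF K] by simp
  finally show ?thesis by (simp add: K_def overlap_def)
qed

lemma overlap_measurable [measurable]: "overlap \<in> borel_measurable borel"
  unfolding overlap_def[abs_def] by measurable

lemma overlap_bounds: "0 \<le> overlap u" "overlap u \<le> measure lborel \<Omega>"
proof -
  have i: "integrable lborel (indicat_real \<Omega>)" using \<Omega>_finite by simp
  have i': "integrable lborel (\<lambda>z. indicat_real \<Omega> z * indicat_real \<Omega> (z + u))"
    by (rule Bochner_Integration.integrable_bound[OF i]) (auto simp: indicator_def)
  show "0 \<le> overlap u" unfolding overlap_def by (rule Bochner_Integration.integral_nonneg) simp
  have "overlap u \<le> (LINT z|lborel. indicat_real \<Omega> z)"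
    unfolding overlap_def by (intro integral_mono i i') (auto simp: indicator_def)
  then show "overlap u \<le> measure lborel \<Omega>" by simp
qed

text \<open>The covariogram is the autocorrelation of 1_\<Omega>, so its continuity at 0 is
  inherited from that of translations in L2, whatever the boundary of \<Omega> looks like.\<close>

lemma overlap_tendsto: "isCont overlap 0" "overlap 0 = measure lborel \<Omega>"
proof -
  let ?f = "\<lambda>z. complex_of_real (indicat_real \<Omega> z)"
  have sq: "(cmod (?f z))\<^sup>2 = indicat_real \<Omega> z" for z
    by (auto simp: indicator_def)
  have f: "?f \<in> L2"
  proof (rule L2I)
    show "integrable lborel (\<lambda>z. (cmod (?f z))\<^sup>2)"
      unfolding sq using \<Omega>_finite by simp
  qed measurable
  have eq: "autocorr ?f u = of_real (overlap u)" for u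
    unfolding autocorr_def overlap_def integral_complex_of_real[symmetric]
    by (rule Bochner_Integration.integral_cong) simp_all
  have "(L2_norm ?f)\<^sup>2 = (LINT z|lborel. indicat_real \<Omega> z)"
    unfolding L2_norm_square sq ..
  then have n: "(L2_norm ?f)\<^sup>2 = measure lborel \<Omega>" by simp
  show z: "overlap 0 = measure lborel \<Omega>"
    using autocorr_0[of ?f] unfolding eq n of_real_eq_iff .
  show "isCont overlap 0"
    unfolding continuous_at_sequentially
    using autocorr_tendsto[OF f] unfolding eq n z tendsto_of_real_iff by (auto simp: o_def)
qed

end

section \<open>The eigenvalue list and the expansion of the energy\<close>

locale tf_eigensystem = tf_window +
  fixes N :: enat and lam :: "nat \<Rightarrow> real" and h :: "nat \<Rightarrow> 'a \<Rightarrow> complex"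
  assumes eigensystem: "ordered_eigensystem (loc_op g \<Omega>) N lam h"
begin

definition I :: "nat set" where "I = {k. 1 \<le> k \<and> enat k \<le> N}"

lemma
  shows h_L2: "k \<in> I \<Longrightarrow> h k \<in> L2"
    and h_eigen: "k \<in> I \<Longrightarrow> AE t in lborel. loc_op g \<Omega> (h k) t = of_real (lam k) * h k t"
    and lam_antimono: "j \<in> I \<Longrightarrow> k \<in> I \<Longrightarrow> j \<le> k \<Longrightarrow> lam k \<le> lam j"
    and h_orthonormal: "j \<in> I \<Longrightarrow> k \<in> I \<Longrightarrow> L2_inner (h j) (h k) = (if j = k then 1 else 0)"
    and exhaustive: "\<mu> \<noteq> 0 \<Longrightarrow> f \<in> eigenspace (loc_op g \<Omega>) \<mu> \<Longrightarrow>
      \<exists>S c. finite S \<and> S \<subseteq> {k \<in> I. of_real (lam k) = \<mu>} \<and> (AE t in lborel. f t = (\<Sum>k\<in>S. c k * h k t))"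
  using eigensystem unfolding ordered_eigensystem_def Let_def I_def[symmetric] eigenspace_def by blast+

lemma I_downward: "1 \<le> j \<Longrightarrow> j \<le> k \<Longrightarrow> k \<in> I \<Longrightarrow> j \<in> I"
  unfolding I_def by (auto intro: order_trans[of "enat j" "enat k"])

text \<open>The list itself only promises non-zero real numbers; that they lie between 0 and 1 comes
  from this identification.\<close>

lemma lam_energy: "k \<in> I \<Longrightarrow> lam k = energy (h k)"
proof -
  assume k: "k \<in> I"
  have "of_real (energy (h k)) = L2_inner (loc_op g \<Omega> (h k)) (h k)"
    using loc_op_energy[OF h_L2[OF k]] by simp
  also have "\<dots> = L2_inner (\<lambda>t. of_real (lam k) * h k t) (h k)"
    using h_L2[OF k] h_eigen[OF k] by (intro L2_inner_cong_AE loc_op_L2 L2_scale)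
  also have "\<dots> = of_real (lam k)"
    using h_orthonormal[OF k k] by (simp add: L2_inner_scale_left)
  finally show ?thesis by simp
qed

text \<open>The eigensystem reindexed from 0 and continued by zeros, so that finite and infinite systems can
  be treated alike.\<close>

definition mu :: "nat \<Rightarrow> real" where "mu k = (if Suc k \<in> I then lam (Suc k) else 0)"

definition ef :: "nat \<Rightarrow> 'a \<Rightarrow> complex" where "ef k = (if Suc k \<in> I then h (Suc k) else (\<lambda>_. 0))"

lemma ef_L2: "ef k \<in> L2"
  by (simp add: ef_def h_L2 L2_zero)

lemma ef_orthogonal: "j \<noteq> k \<Longrightarrow> L2_inner (ef j) (ef k) = 0"
  by (simp add: ef_def h_orthonormal) (simp add: L2_inner_def)

lemma ef_norm: "(L2_norm (ef k))\<^sup>2 = (if Suc k \<in> I then 1 else 0)"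
proof -
  have "of_real ((L2_norm (ef k))\<^sup>2) = (if Suc k \<in> I then 1 else (0::complex))"
    unfolding L2_inner_self[symmetric] ef_def using h_orthonormal[of "Suc k" "Suc k"]
    by (auto simp: L2_inner_def)
  then show ?thesis by (cases "Suc k \<in> I") (simp_all del: of_real_power)
qed

lemma ef_eigen: "AE t in lborel. loc_op g \<Omega> (ef k) t = of_real (mu k) * ef k t"
proof (cases "Suc k \<in> I")
  case True
  then show ?thesis using h_eigen by (simp add: ef_def mu_def)
next
  case False
  have "loc_op g \<Omega> (\<lambda>_. 0) t = 0" for t
    by (simp add: loc_op_eq_synth synth_def stft_eq)
  with False show ?thesis by (simp add: ef_def)
qed

lemma mu_energy: "mu k = energy (ef k)"
proof (cases "Suc k \<in> I")
  case False
  have "energy (\<lambda>_. 0) = 0" using energy_scale[of 0 "\<lambda>_. 0"] by simp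
  with False show ?thesis by (simp add: mu_def ef_def)
qed (simp add: mu_def ef_def lam_energy)

lemma mu_nonneg: "0 \<le> mu k"
  by (simp add: mu_energy energy_nonneg)

lemma mu_le_1: "mu k \<le> 1"
  using energy_le[OF ef_L2[of k]] ef_norm[of k] by (simp add: mu_energy split: if_splits)

lemma mu_antimono: "j \<le> k \<Longrightarrow> mu k \<le> mu j"
proof (cases "Suc k \<in> I")
  case True
  assume "j \<le> k"
  with True show ?thesis
    using I_downward[of "Suc j" "Suc k"] by (simp add: mu_def lam_antimono)
qed (simp add: mu_def[of k] mu_nonneg)

lemma loc_op_ef_inner:
  assumes f: "f \<in> L2"
  shows "L2_inner (cut_stft f) (cut_stft (ef k)) = of_real (mu k) * L2_inner f (ef k)"
proof -
  have "L2_inner (cut_stft f) (cut_stft (ef k)) = L2_inner f (loc_op g \<Omega> (ef k))"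
    using loc_op_inner[OF f ef_L2] loc_op_symmetric[OF f ef_L2] by simp
  also have "\<dots> = cnj (L2_inner (loc_op g \<Omega> (ef k)) f)"
    by (rule L2_inner_commute)
  also have "L2_inner (loc_op g \<Omega> (ef k)) f = L2_inner (\<lambda>t. of_real (mu k) * ef k t) f"
    using ef_L2 f ef_eigen by (intro L2_inner_cong_AE loc_op_L2 L2_scale)
  also have "cnj \<dots> = of_real (mu k) * L2_inner f (ef k)"
    by (simp add: L2_inner_scale_left L2_inner_commute[of f])
  finally show ?thesis .
qed

text \<open>Treats both kinds of index at once: a genuine eigenfunction has norm 1, and for a
  padding zero both sides vanish.\<close>

lemma ef_inner_absorb: "f \<in> L2 \<Longrightarrow> L2_inner f (ef k) * of_real ((L2_norm (ef k))\<^sup>2) = L2_inner f (ef k)"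
  unfolding ef_norm by (auto simp: ef_def L2_inner_def)

text \<open>Since \<open>ef k\<close> is an eigenfunction, the mixed term of the energy is
  \<open>mu k\<close> times the coefficient, so removing the component lowers the energy by exactly
  its own share.\<close>

lemma remove_ef:
  fixes k :: nat
  assumes f: "f \<in> L2"
  defines "f' \<equiv> \<lambda>t. f t - L2_inner f (ef k) * ef k t"
  shows "f' \<in> L2" "L2_inner f' (ef k) = 0" "j \<noteq> k \<Longrightarrow> L2_inner f' (ef j) = L2_inner f (ef j)"
    "energy f' = energy f - mu k * (cmod (L2_inner f (ef k)))\<^sup>2" "L2_norm f' \<le> L2_norm f"
proof -
  let ?c = "L2_inner f (ef k)"
  have ck: "(\<lambda>t. ?c * ef k t) \<in> L2" by (rule L2_scale[OF ef_L2])
  show f': "f' \<in> L2" unfolding f'_def by (intro L2_diff f ck)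
  have inner: "L2_inner f' (ef j) = L2_inner f (ef j) - ?c * L2_inner (ef k) (ef j)" for j
    unfolding f'_def using f ck ef_L2 by (simp add: L2_inner_diff_left L2_inner_scale_left)
  show "L2_inner f' (ef k) = 0"
    unfolding inner L2_inner_self using ef_inner_absorb[OF f] by simp
  show "L2_inner f' (ef j) = L2_inner f (ef j)" if "j \<noteq> k"
    using that by (simp add: inner ef_orthogonal)
  have "cut_stft f' = (\<lambda>z. cut_stft f z - ?c * cut_stft (ef k) z)"
    unfolding cut_stft_def f'_def stft_diff[OF f ck g] stft_scale by (simp add: algebra_simps)
  then have "energy f' = (L2_norm (\<lambda>z. cut_stft f z - ?c * cut_stft (ef k) z))\<^sup>2"
    by (simp only: energy_def)
  also have "\<dots> = energy f - 2 * mu k * (cmod ?c)\<^sup>2 + (cmod ?c)\<^sup>2 * mu k"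
    unfolding mu_energy[of k] energy_def
    by (intro L2_norm_diff_scale cut_stft_L2 f ef_L2) (use loc_op_ef_inner[OF f, of k] in \<open>simp add: mu_energy energy_def\<close>)
  finally show "energy f' = energy f - mu k * (cmod ?c)\<^sup>2" by simp
  have "(L2_norm f')\<^sup>2 = (L2_norm f)\<^sup>2 - 2 * 1 * (cmod ?c)\<^sup>2 + (cmod ?c)\<^sup>2 * (L2_norm (ef k))\<^sup>2"
    unfolding f'_def by (intro L2_norm_diff_scale f ef_L2) simp
  also have "\<dots> \<le> (L2_norm f)\<^sup>2"
    unfolding ef_norm by simp
  finally show "L2_norm f' \<le> L2_norm f"
    by (rule power2_le_imp_le) (rule L2_norm_nonneg)
qed

lemma remove_efs:
  assumes f: "f \<in> L2"
  obtains f' where "f' \<in> L2" "\<And>j. j < n \<Longrightarrow> L2_inner f' (ef j) = 0"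
    "energy f' = energy f - (\<Sum>k<n. mu k * (cmod (L2_inner f (ef k)))\<^sup>2)" "L2_norm f' \<le> L2_norm f"
proof -
  \<comment> \<open>The induction also records that later coefficients are unchanged; this lets the
    energy formula speak of the coefficients of the original \<open>f\<close>.\<close>
  have "\<exists>f'\<in>L2. (\<forall>j<n. L2_inner f' (ef j) = 0) \<and> (\<forall>j\<ge>n. L2_inner f' (ef j) = L2_inner f (ef j)) \<and>
    energy f' = energy f - (\<Sum>k<n. mu k * (cmod (L2_inner f (ef k)))\<^sup>2) \<and> L2_norm f' \<le> L2_norm f"
  proof (induction n)
    case 0
    then show ?case using f by auto
  next
    case (Suc n)
    then obtain f' where f': "f' \<in> L2" "\<And>j. j < n \<Longrightarrow> L2_inner f' (ef j) = 0"
      "\<And>j. j \<ge> n \<Longrightarrow> L2_inner f' (ef j) = L2_inner f (ef j)"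
      "energy f' = energy f - (\<Sum>k<n. mu k * (cmod (L2_inner f (ef k)))\<^sup>2)" "L2_norm f' \<le> L2_norm f"
      by blast
    show ?case
      using f' remove_ef[OF f'(1), where k=n]
      by (intro bexI[of _ "\<lambda>t. f' t - L2_inner f' (ef n) * ef n t"]) (auto simp: less_Suc_eq)
  qed
  then show ?thesis using that by blast
qed

text \<open>The only use of the exhaustiveness of the list. A maximiser y of positive norm is a
  finite combination of listed eigenfunctions with eigenvalue m; being orthogonal to the leading n
  of them, it must involve some \<open>h k\<close> with k > n, so m = lam k <= lam (n + 1) = mu
  n.\<close>

lemma energy_perp_le:
  assumes f: "f \<in> L2" "\<And>j. j < n \<Longrightarrow> L2_inner f (ef j) = 0"
  shows "energy f \<le> mu n * (L2_norm f)\<^sup>2"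
proof -
  \<comment> \<open>The one-based indices 1, ..., n of the list that correspond to
    \<open>ef 0\<close>, ..., \<open>ef (n - 1)\<close>.\<close>
  define J where "J = {k \<in> I. k \<le> n}"
  have fJ: "f \<in> perp J h"
    unfolding perp_def
  proof (intro CollectI conjI ballI f)
    fix k assume "k \<in> J"
    then have k: "k \<in> I" "k \<le> n" "1 \<le> k" by (auto simp: J_def I_def)
    then show "L2_inner f (h k) = 0"
      using f(2)[of "k - 1"] by (simp add: ef_def)
  qed
  obtain m where m: "m \<ge> 0" "\<And>f. f \<in> perp J h \<Longrightarrow> energy f \<le> m * (L2_norm f)\<^sup>2"
    "m = 0 \<or> (\<exists>y\<in>perp J h. (\<forall>t. loc_op g \<Omega> y t = of_real m * y t) \<and> L2_norm y \<noteq> 0)"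
    by (rule perp_eigenfunction[of J h lam]) (auto simp: J_def h_L2 h_eigen)
  have "m \<le> mu n"
  proof (cases "m = 0")
    case False
    with m(3) obtain y where y: "y \<in> perp J h" "\<And>t. loc_op g \<Omega> y t = of_real m * y t" "L2_norm y \<noteq> 0"
      by blast
    have yL: "y \<in> L2" using y(1) by (simp add: perp_def)
    have "y \<in> eigenspace (loc_op g \<Omega>) (of_real m)"
      using y yL by (simp add: eigenspace_def)
    then obtain S c where S: "finite S" "S \<subseteq> {k \<in> I. complex_of_real (lam k) = of_real m}"
      "AE t in lborel. y t = (\<Sum>k\<in>S. c k * h k t)"
      using exhaustive[of "of_real m" y] False by auto
    have hS: "(\<lambda>t. c k * h k t) \<in> L2" if "k \<in> S" for k
      using S(2) that by (intro L2_scale h_L2) auto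
    \<comment> \<open>Pairing y with its own expansion: a positive norm forces one summand to be
      non-zero, and its index cannot lie in \<open>J\<close>.\<close>
    have "of_real ((L2_norm y)\<^sup>2) = L2_inner (\<lambda>t. \<Sum>k\<in>S. c k * h k t) y"
      unfolding L2_inner_self[symmetric] using S(3) yL hS by (intro L2_inner_cong_AE L2_sum)
    also have "\<dots> = (\<Sum>k\<in>S. c k * L2_inner (h k) y)"
      using hS yL by (simp add: L2_inner_sum_left L2_inner_scale_left)
    finally have "(\<Sum>k\<in>S. c k * L2_inner (h k) y) \<noteq> 0"
      using y(3) by auto
    then obtain k where "k \<in> S" "c k * L2_inner (h k) y \<noteq> 0"
      by (rule sum.not_neutral_contains_not_neutral)
    then have k: "k \<in> S" "L2_inner (h k) y \<noteq> 0" by auto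
    then have "k \<notin> J"
      using y(1) L2_inner_commute[of "h k" y] by (auto simp: perp_def)
    moreover have kI: "k \<in> I" "lam k = m" using S(2) k(1) by auto
    ultimately have kn: "Suc n \<le> k" by (auto simp: J_def)
    then have "Suc n \<in> I" using I_downward[of "Suc n" k] kI by simp
    then show ?thesis using lam_antimono[OF _ kI(1) kn] kI(2) by (simp add: mu_def)
  qed (simp add: mu_nonneg)
  then have "m * (L2_norm f)\<^sup>2 \<le> mu n * (L2_norm f)\<^sup>2" by (rule mult_right_mono) simp
  with m(2)[OF fJ] show ?thesis by simp
qed

text \<open>Takes the place of the spectral theorem: what remains after removing n components has
  nonnegative energy, and by the variational bound at most \<open>mu n\<close> times the squared
  norm.\<close>

lemma energy_expansion_bounds:
  assumes f: "f \<in> L2"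
  shows "(\<Sum>k<n. mu k * (cmod (L2_inner f (ef k)))\<^sup>2) \<le> energy f"
    and "energy f \<le> (\<Sum>k<n. mu k * (cmod (L2_inner f (ef k)))\<^sup>2) + mu n * (L2_norm f)\<^sup>2"
proof -
  obtain f' where f': "f' \<in> L2" "\<And>j. j < n \<Longrightarrow> L2_inner f' (ef j) = 0"
    "energy f' = energy f - (\<Sum>k<n. mu k * (cmod (L2_inner f (ef k)))\<^sup>2)" "L2_norm f' \<le> L2_norm f"
    using remove_efs[OF f, of n] by blast
  show "(\<Sum>k<n. mu k * (cmod (L2_inner f (ef k)))\<^sup>2) \<le> energy f"
    using f'(3) energy_nonneg[of f'] by simp
  have "energy f' \<le> mu n * (L2_norm f')\<^sup>2"
    by (rule energy_perp_le[OF f'(1,2)])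
  also have "\<dots> \<le> mu n * (L2_norm f)\<^sup>2"
    using f'(4) by (intro mult_left_mono power_mono mu_nonneg L2_norm_nonneg)
  finally show "energy f \<le> (\<Sum>k<n. mu k * (cmod (L2_inner f (ef k)))\<^sup>2) + mu n * (L2_norm f)\<^sup>2"
    using f'(3) by simp
qed

lemma cmod_inner_ef: "cmod (L2_inner (tf_shift g z) (ef k)) = cmod (stft g (ef k) z)"
  unfolding stft_eq_inner using L2_inner_commute[of "tf_shift g z" "ef k"] by simp

section \<open>Spectrogram expansion and trace formulas\<close>

definition term_spec :: "nat \<Rightarrow> 'a \<times> 'a \<Rightarrow> real" where
  "term_spec k z = (cmod (stft g (ef k) z))\<^sup>2"

lemma term_spec_measurable [measurable]: "term_spec k \<in> borel_measurable borel"
  using stft_borel[OF ef_L2, of k] unfolding term_spec_def[abs_def] by measurable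

lemma term_spec_nonneg: "0 \<le> term_spec k z"
  by (simp add: term_spec_def)

lemma term_spec_integrable: "integrable lborel (term_spec k)"
  unfolding term_spec_def[abs_def] by (rule L2_integrable[OF stft_L2(1)[OF ef_L2 g]])

lemma term_spec_integral: "(LINT z|lborel. term_spec k z) = (if Suc k \<in> I then 1 else 0)"
  unfolding term_spec_def L2_norm_square[symmetric] stft_L2(2)[OF ef_L2 g] g_norm
  by (simp add: ef_norm)

lemma mu_term_spec_integral: "mu k * (LINT z|lborel. term_spec k z) = mu k"
  unfolding term_spec_integral by (simp add: mu_def)

lemma blur_expansion_bounds:
  "(\<Sum>k<n. mu k * term_spec k z) \<le> blur z"
  "blur z \<le> (\<Sum>k<n. mu k * term_spec k z) + mu n"
  using energy_expansion_bounds[OF tf_shift_L2[OF g, of z], where n=n]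
  by (simp_all add: cmod_inner_ef energy_tf_shift term_spec_def L2_norm_tf_shift g g_norm)

text \<open>Half of the trace formula, from the lower bound alone. It already gives summability,
  hence \<open>mu n\<close> tends to 0, which is what makes the remainder in
  \<open>blur_expansion_bounds\<close> vanish.\<close>

lemma mu_sum_le: "(\<Sum>k<n. mu k) \<le> measure lborel \<Omega>"
proof -
  have "(\<Sum>k<n. mu k) = (LINT z|lborel. (\<Sum>k<n. mu k * term_spec k z))"
    using term_spec_integrable by (simp add: mu_term_spec_integral)
  also have "\<dots> \<le> (LINT z|lborel. blur z)"
    using term_spec_integrable blur_integrable by (intro integral_mono) (auto simp: blur_expansion_bounds)
  finally show ?thesis by (simp add: blur_integral)
qed

lemma mu_summable: "summable mu"
  by (rule summableI_nonneg_bounded[OF mu_nonneg mu_sum_le])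

lemma blur_sums: "(\<lambda>k. mu k * term_spec k z) sums blur z"
proof -
  have "(\<lambda>n. blur z - mu n) \<longlonglongrightarrow> blur z - 0"
    by (intro tendsto_intros summable_LIMSEQ_zero mu_summable)
  then have lim: "(\<lambda>n. blur z - mu n) \<longlonglongrightarrow> blur z" by simp
  have "blur z - mu n \<le> (\<Sum>k<n. mu k * term_spec k z)" for n
    using blur_expansion_bounds(2)[where z=z and n=n] by simp
  then show ?thesis
    unfolding sums_def
    by (intro tendsto_sandwich[OF _ _ lim tendsto_const]) (simp_all add: blur_expansion_bounds(1))
qed

text \<open>Applied with the whole phase space for the trace and with \<Omega> for the trace of the
  square; nonnegativity of the terms permits the exchange of sum and integral.\<close>

lemma nn_integral_weighted_blur:
  assumes [measurable]: "A \<in> sets borel"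
  shows "(\<integral>\<^sup>+z. ennreal (indicat_real A z * blur z) \<partial>lborel) =
    (\<Sum>k. ennreal (mu k * (LINT z|lborel. indicat_real A z * term_spec k z)))"
proof -
  have i: "integrable lborel (\<lambda>z. indicat_real A z * term_spec k z)" for k
    by (rule Bochner_Integration.integrable_bound[OF term_spec_integrable[of k]])
      (auto simp: indicator_def term_spec_nonneg)
  have "ennreal (indicat_real A z * blur z) = (\<Sum>k. ennreal (mu k * (indicat_real A z * term_spec k z)))" for z
  proof -
    have "(\<lambda>k. mu k * (indicat_real A z * term_spec k z)) sums (indicat_real A z * blur z)"
      using sums_mult[OF blur_sums[of z], of "indicat_real A z"] by (simp only: mult.left_commute)
    then show ?thesis
      by (intro suminf_ennreal_eq[symmetric]) (simp_all add: mu_nonneg term_spec_nonneg)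
  qed
  then have eq: "(\<integral>\<^sup>+z. ennreal (indicat_real A z * blur z) \<partial>lborel) =
      (\<Sum>k. \<integral>\<^sup>+z. ennreal (mu k * (indicat_real A z * term_spec k z)) \<partial>lborel)"
    by (simp add: nn_integral_suminf)
  have "(\<integral>\<^sup>+z. ennreal (mu k * (indicat_real A z * term_spec k z)) \<partial>lborel) =
      ennreal (mu k * (LINT z|lborel. indicat_real A z * term_spec k z))" for k
    using i[of k] by (subst nn_integral_eq_integral) (simp_all add: mu_nonneg term_spec_nonneg)
  with eq show ?thesis by simp
qed

lemma mu_sums: "mu sums measure lborel \<Omega>"
proof -
  have "ennreal (measure lborel \<Omega>) = (\<Sum>k. ennreal (mu k))"
    using nn_integral_weighted_blur[of UNIV] by (simp add: nn_integral_blur mu_term_spec_integral)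
  also have "\<dots> = ennreal (suminf mu)"
    by (rule suminf_ennreal_eq[OF mu_nonneg summable_sums[OF mu_summable]])
  finally have "measure lborel \<Omega> = suminf mu"
    by (simp add: suminf_nonneg mu_summable mu_nonneg)
  then show ?thesis using summable_sums[OF mu_summable] by simp
qed

lemma mu_square_sums: "(\<lambda>k. (mu k)\<^sup>2) sums trace2"
proof -
  have s: "summable (\<lambda>k. (mu k)\<^sup>2)"
    by (rule summable_comparison_test'[OF mu_summable, of 0])
      (use mu_nonneg mu_le_1 in \<open>auto simp: power2_eq_square intro: mult_left_le\<close>)
  \<comment> \<open>The integral of the spectrogram of an eigenfunction over \<Omega> is its energy,
    that is, the eigenvalue once more.\<close>
  have "mu k * (LINT z|lborel. indicat_real \<Omega> z * term_spec k z) = (mu k)\<^sup>2" for k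
    unfolding term_spec_def energy_eq[symmetric] mu_energy[symmetric]
    by (rule power2_eq_square[symmetric])
  then have "(\<integral>\<^sup>+z. ennreal (indicat_real \<Omega> z * blur z) \<partial>lborel) = (\<Sum>k. ennreal ((mu k)\<^sup>2))"
    by (simp only: nn_integral_weighted_blur[OF \<Omega>_borel])
  also have "\<dots> = ennreal (\<Sum>k. (mu k)\<^sup>2)"
    by (rule suminf_ennreal_eq[OF _ summable_sums[OF s]]) simp
  also have "(\<integral>\<^sup>+z. ennreal (indicat_real \<Omega> z * blur z) \<partial>lborel) = ennreal trace2"
    unfolding trace2_def by (rule nn_integral_eq_integral[OF blur_cut_integrable]) (simp add: blur_nonneg)
  finally have "trace2 = (\<Sum>k. (mu k)\<^sup>2)"
    by (simp add: suminf_nonneg s trace2_def Bochner_Integration.integral_nonneg blur_nonneg)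
  then show ?thesis using summable_sums[OF s] by simp
qed

section \<open>Comparison of the accumulated spectrogram with the indicator\<close>

abbreviation A :: nat where "A \<equiv> A_count \<Omega>"

lemma A_bounds: "measure lborel \<Omega> \<le> real A" "real A \<le> measure lborel \<Omega> + 1" "k < A \<Longrightarrow> real k < measure lborel \<Omega>"
  unfolding A_count_def using measure_nonneg[of lborel \<Omega>] by linarith+

text \<open>As the \<open>mu k\<close> add up to |\<Omega>|, this is the tail bound by the sum of mu
  k (1 - mu k), rearranged.\<close>

lemma trace2_le: "trace2 \<le> (\<Sum>k<A. mu k)"
proof -
  let ?m = "measure lborel \<Omega>"
  have s: "(\<lambda>k. if k \<in> {..<A} then f k else 0) sums (\<Sum>k<A. f k)" for f :: "nat \<Rightarrow> real"
    by (rule sums_If_finite_set) simp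
  have sums1: "(\<lambda>k. (if k \<in> {..<A} then mu k else 0) - (mu k)\<^sup>2) sums ((\<Sum>k<A. mu k) - trace2)"
    by (intro sums_diff s mu_square_sums)
  have sums2: "(\<lambda>k. mu A * ((if k \<in> {..<A} then 1 else 0) - mu k)) sums (mu A * ((\<Sum>k<A. 1) - ?m))"
    by (intro sums_mult sums_diff s mu_sums)
  \<comment> \<open>Termwise comparison with the threshold \<open>mu A\<close>: below
    \<open>A\<close> the gap between the two sides is (mu k - mu A) (1 - mu k), from
    \<open>A\<close> on it is mu k (mu A - mu k). Summed up, the left side is mu A (A - |\<Omega>|),
    nonnegative because A rounds |\<Omega>| up.\<close>
  have le: "mu A * ((if k \<in> {..<A} then 1 else 0) - mu k) \<le> (if k \<in> {..<A} then mu k else 0) - (mu k)\<^sup>2" for k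
  proof (cases "k < A")
    case True
    then have "0 \<le> (mu k - mu A) * (1 - mu k)"
      using mu_antimono[of k A] mu_le_1[of k] by (intro mult_nonneg_nonneg) auto
    with True show ?thesis by (simp add: power2_eq_square algebra_simps)
  next
    case False
    then have "mu k * mu k \<le> mu A * mu k"
      using mu_antimono[of A k] by (intro mult_right_mono mu_nonneg) auto
    with False show ?thesis by (simp add: power2_eq_square)
  qed
  have "mu A * ((\<Sum>k<A. 1) - ?m) \<le> (\<Sum>k<A. mu k) - trace2"
    by (rule sums_le[OF le sums2 sums1])
  moreover have "0 \<le> mu A * ((\<Sum>k<A. 1) - ?m)"
    using A_bounds(1) by (intro mult_nonneg_nonneg mu_nonneg) simp
  ultimately show ?thesis by simp
qed

text \<open>A list with at most k entries, each at most 1, would have sum at most k < |\<Omega>|,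
  against the trace formula. So the accumulated spectrogram never reaches the unspecified values of
  \<open>h\<close>.\<close>

lemma Suc_mem_I: "k < A \<Longrightarrow> Suc k \<in> I"
proof (rule ccontr)
  assume k: "k < A" "Suc k \<notin> I"
  have "mu j = 0" if "j \<ge> k" for j
    using I_downward[of "Suc k" "Suc j"] k(2) that by (auto simp: mu_def)
  then have "mu sums (\<Sum>j<k. mu j)"
    by (intro sums_finite) auto
  then have "measure lborel \<Omega> = (\<Sum>j<k. mu j)"
    using mu_sums by (rule sums_unique2[rotated])
  also have "\<dots> \<le> (\<Sum>j<k. 1)" by (intro sum_mono mu_le_1)
  finally show False using A_bounds(3)[OF k(1)] by simp
qed

lemma acc_spectrogram_eq: "acc_spectrogram g \<Omega> h z = (\<Sum>k<A. term_spec k z)"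
  unfolding acc_spectrogram_def term_spec_def One_nat_def sum.atLeast1_atMost_eq
  by (intro sum.cong) (simp_all add: ef_def Suc_mem_I)

lemma acc_spectrogram_integrable: "integrable lborel (acc_spectrogram g \<Omega> h)"
  unfolding acc_spectrogram_eq[abs_def] using term_spec_integrable by simp

text \<open>With m = |\<Omega>|, s the sum of the leading A eigenvalues and T =
  \<open>trace2\<close>, the three brackets of the pointwise bound integrate to A - s, m - s and 2 m
  - 2 T. The third has no modulus because 0 <= B <= 1 makes |B - 1_\<Omega>| linear in 1_\<Omega>, B
  and their product. Now T <= s and A <= m + 1; the summand 1 is the cost of rounding m up to
  A.\<close>

lemma acc_spectrogram_L1_bound:
  "(LINT z|lborel. \<bar>acc_spectrogram g \<Omega> h z - indicat_real \<Omega> z\<bar>) \<le> 1 + 4 * (measure lborel \<Omega> - trace2)"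
proof -
  let ?m = "measure lborel \<Omega>" and ?s = "\<Sum>k<A. mu k"
  have i\<Omega>: "integrable lborel (indicat_real \<Omega>)" using \<Omega>_finite by simp
  have "\<bar>acc_spectrogram g \<Omega> h z - indicat_real \<Omega> z\<bar> \<le>
      ((\<Sum>k<A. term_spec k z) - (\<Sum>k<A. mu k * term_spec k z)) + (blur z - (\<Sum>k<A. mu k * term_spec k z)) +
      (indicat_real \<Omega> z + blur z - 2 * (indicat_real \<Omega> z * blur z))" for z
  proof -
    have "(\<Sum>k<A. mu k * term_spec k z) \<le> (\<Sum>k<A. term_spec k z)"
      by (intro sum_mono mult_left_le_one_le mu_nonneg mu_le_1 term_spec_nonneg)
    moreover have "\<bar>blur z - indicat_real \<Omega> z\<bar> = indicat_real \<Omega> z + blur z - 2 * (indicat_real \<Omega> z * blur z)"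
      using blur_nonneg[of z] blur_le_1[of z] by (simp add: indicator_def)
    ultimately show ?thesis
      using blur_expansion_bounds(1)[where n=A and z=z] unfolding acc_spectrogram_eq by linarith
  qed
  then have "(LINT z|lborel. \<bar>acc_spectrogram g \<Omega> h z - indicat_real \<Omega> z\<bar>) \<le>
      (LINT z|lborel. ((\<Sum>k<A. term_spec k z) - (\<Sum>k<A. mu k * term_spec k z)) + (blur z - (\<Sum>k<A. mu k * term_spec k z)) +
      (indicat_real \<Omega> z + blur z - 2 * (indicat_real \<Omega> z * blur z)))"
    using i\<Omega> acc_spectrogram_integrable term_spec_integrable blur_integrable blur_cut_integrable
    by (intro integral_mono) auto
  also have "\<dots> = (real A - ?s) + (?m - ?s) + (?m + ?m - 2 * trace2)"
    using i\<Omega> term_spec_integrable blur_integrable blur_cut_integrable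
    by (simp add: mu_term_spec_integral term_spec_integral Suc_mem_I blur_integral trace2_def)
  also have "\<dots> \<le> 1 + 4 * (?m - trace2)"
    using trace2_le A_bounds(2) by simp
  finally show ?thesis .
qed

end

section \<open>Convergence of accumulated spectrograms\<close>

theorem theorem1p3:
  fixes g :: "'a::euclidean_space \<Rightarrow> complex"
    and \<Omega> :: "('a \<times> 'a) set"
    and N :: "real \<Rightarrow> enat"
    and lam :: "real \<Rightarrow> nat \<Rightarrow> real"
    and h :: "real \<Rightarrow> nat \<Rightarrow> 'a \<Rightarrow> complex"
  assumes "g \<in> L2" and "L2_norm g = 1"
    and "compact \<Omega>"
    and "\<And>R. R > 0 \<Longrightarrow> ordered_eigensystem (loc_op g (dilate R \<Omega>)) (N R) (lam R) (h R)"
  shows "L1_tendsto (\<lambda>R z. acc_spectrogram g (dilate R \<Omega>) (h R) (R *\<^sub>R z)) (indicator \<Omega>) at_top"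
proof -
  interpret W: tf_window g \<Omega>
    using assms by unfold_locales
  let ?D = "DIM('a \<times> 'a)" and ?m = "measure lborel \<Omega>"
  let ?\<rho> = "\<lambda>R z. acc_spectrogram g (dilate R \<Omega>) (h R) (R *\<^sub>R z)"
  \<comment> \<open>\<open>?I R\<close> is \<open>trace2\<close> of the dilated set divided by
    R^(2d); its limit is the total mass 1 of \<open>ambig\<close> times |\<Omega>|.\<close>
  let ?I = "\<lambda>R. LINT u|lborel. W.ambig u * W.overlap (inverse R *\<^sub>R u)"
  have eig: "tf_eigensystem g (dilate R \<Omega>) (N R) (lam R) (h R)" if "R > 0" for R
    using assms that by unfold_locales (auto simp: dilate_def compact_scaling)
  have ind: "indicat_real (dilate R \<Omega>) (R *\<^sub>R z) = indicat_real \<Omega> z" if "R > 0" for R z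
    using that by (simp add: dilate_def indicator_def inj_image_mem_iff injective_scaleR)
  have i\<Omega>: "integrable lborel (indicat_real \<Omega>)" using W.\<Omega>_finite by simp
  have bound: "integrable lborel (?\<rho> R)"
    "(LINT z|lborel. \<bar>?\<rho> R z - indicat_real \<Omega> z\<bar>) \<le> inverse R ^ ?D + 4 * (?m - ?I R)" if R: "R > 0" for R
  proof -
    interpret E: tf_eigensystem g "dilate R \<Omega>" "N R" "lam R" "h R"
      by (rule eig[OF R])
    have [measurable]: "acc_spectrogram g (dilate R \<Omega>) (h R) \<in> borel_measurable borel"
      using E.acc_spectrogram_integrable by (simp add: borel_measurable_integrable)
    show "integrable lborel (?\<rho> R)"
      using E.acc_spectrogram_integrable R
        integrable_lborel_affine_iff[of R "acc_spectrogram g (dilate R \<Omega>) (h R)" 0] by simp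
    have m: "measure lborel (dilate R \<Omega>) = R ^ ?D * ?m"
      using integral_lborel_affine[of R "indicat_real (dilate R \<Omega>)" 0] R by (simp add: ind)
    \<comment> \<open>A shift by u of the dilated set is a shift by u / R of \<Omega>, and the
      substitution z -> R z contributes the Jacobian.\<close>
    have "E.overlap u = R ^ ?D * W.overlap (inverse R *\<^sub>R u)" for u
    proof -
      have "indicat_real (dilate R \<Omega>) (R *\<^sub>R z + u) = indicat_real \<Omega> (z + inverse R *\<^sub>R u)" for z
        using ind[OF R, of "z + inverse R *\<^sub>R u"] R by (simp add: scaleR_add_right)
      then show ?thesis
        unfolding E.overlap_def W.overlap_def
        using integral_lborel_affine[of R "\<lambda>z. indicat_real (dilate R \<Omega>) z * indicat_real (dilate R \<Omega>) (z + u)" 0] R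
        by (simp add: ind)
    qed
    then have T: "E.trace2 = R ^ ?D * ?I R"
      unfolding E.trace2_overlap by (simp add: E.ambig_def W.ambig_def mult.left_commute)
    have "R ^ ?D * (LINT z|lborel. \<bar>?\<rho> R z - indicat_real \<Omega> z\<bar>) =
        (LINT z|lborel. \<bar>acc_spectrogram g (dilate R \<Omega>) (h R) z - indicat_real (dilate R \<Omega>) z\<bar>)"
      using R integral_lborel_affine[of R "\<lambda>z. \<bar>acc_spectrogram g (dilate R \<Omega>) (h R) z - indicat_real (dilate R \<Omega>) z\<bar>" 0]
      by (simp add: ind)
    also have "\<dots> \<le> 1 + 4 * (R ^ ?D * ?m - R ^ ?D * ?I R)"
      using E.acc_spectrogram_L1_bound by (simp only: m T)
    \<comment> \<open>Factoring out the Jacobian turns the rounding error 1 into R^(-2d).\<close>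
    also have "\<dots> = R ^ ?D * (inverse R ^ ?D + 4 * (?m - ?I R))"
      using R by (simp add: algebra_simps flip: power_mult_distrib)
    finally show "(LINT z|lborel. \<bar>?\<rho> R z - indicat_real \<Omega> z\<bar>) \<le> inverse R ^ ?D + 4 * (?m - ?I R)"
      by (rule mult_left_le_imp_le) (use R in simp)
  qed
  \<comment> \<open>Approximate identity argument: the covariogram at u / R tends to its value
    |\<Omega>| at 0, which is also its maximum, so \<open>ambig\<close> times |\<Omega>|
    dominates.\<close>
  have "(?I \<longlongrightarrow> (LINT u|lborel. W.ambig u * ?m)) at_top"
  proof (rule integral_dominated_convergence_at_top[where w="\<lambda>u. W.ambig u * ?m"])
    show "AE u in lborel. ((\<lambda>R. W.ambig u * W.overlap (inverse R *\<^sub>R u)) \<longlongrightarrow> W.ambig u * ?m) at_top"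
    proof (intro AE_I2 tendsto_mult tendsto_const)
      fix u :: "'a \<times> 'a"
      have "((\<lambda>R::real. inverse R *\<^sub>R u) \<longlongrightarrow> 0 *\<^sub>R u) at_top"
        by (intro tendsto_scaleR tendsto_const tendsto_inverse_0_at_top filterlim_ident)
      then show "((\<lambda>R. W.overlap (inverse R *\<^sub>R u)) \<longlongrightarrow> ?m) at_top"
        using isCont_tendsto_compose[OF W.overlap_tendsto(1)] W.overlap_tendsto(2) by simp
    qed
    show "\<forall>\<^sub>F R in at_top. AE u in lborel. norm (W.ambig u * W.overlap (inverse R *\<^sub>R u)) \<le> W.ambig u * ?m"
      by (intro always_eventually allI AE_I2)
        (simp add: abs_mult W.ambig_nonneg W.overlap_bounds mult_left_mono)
  qed (use W.ambig_integrable in auto)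
  then have "(?I \<longlongrightarrow> ?m) at_top" by (simp add: W.ambig_integral)
  then have "((\<lambda>R. inverse R ^ ?D + 4 * (?m - ?I R)) \<longlongrightarrow> 0 ^ ?D + 4 * (?m - ?m)) at_top"
    by (intro tendsto_intros tendsto_inverse_0_at_top filterlim_ident)
  \<comment> \<open>The limit \<open>0 ^ ?D\<close> is 0 because phase space has positive
    dimension.\<close>
  then have lim: "((\<lambda>R. inverse R ^ ?D + 4 * (?m - ?I R)) \<longlongrightarrow> 0) at_top"
    by (simp add: power_0_left)
  show ?thesis
    unfolding L1_tendsto_def
  proof (intro conjI i\<Omega>)
    show "\<forall>\<^sub>F R in at_top. integrable lborel (?\<rho> R)"
      using eventually_gt_at_top[of 0] by eventually_elim (rule bound(1))
    show "((\<lambda>R. LINT z|lborel. \<bar>?\<rho> R z - indicat_real \<Omega> z\<bar>) \<longlongrightarrow> 0) at_top"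
    proof (rule tendsto_sandwich[OF _ _ tendsto_const lim])
      show "\<forall>\<^sub>F R in at_top. (LINT z|lborel. \<bar>?\<rho> R z - indicat_real \<Omega> z\<bar>) \<le> inverse R ^ ?D + 4 * (?m - ?I R)"
        using eventually_gt_at_top[of 0] by eventually_elim (rule bound(2))
    qed simp
  qed
qed

end
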